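(* Let $\Omega \subset \mathbb{R}^n$ be a connected bounded domain with $\mathcal{C}^1$ boundary. Let $C = \lambda_1^{-1/2}$ be the optimal Poincaré constant on $\Omega$, where $\lambda_1>0$ is the smallest eigenvalue of $-\Delta$ on $H_0^1(\Omega)$. Assume that $F:\mathbb{C}\to\mathbb{C}$ is a globally Lipschitz function with Lipschitz constant $C_1$ satisfying $C_1C^2<1$, and let $f\in L^2(\Omega)$. Then the Dirichlet problem for the nonlinear elliptic equation $$-\Delta u + F(u) = f \ \text{ in } \Omega, \qquad u|_{\partial\Omega}=0,$$ has a unique weak solution $u\in H_0^1(\Omega)$.
   Context: All function spaces consist of complex-valued functions. A domain is an open subset of $\mathbb{R}^n$. $H^1_0(\Omega)$ is the completion of $\mathcal{C}_c^\infty(\Omega,\mathbb{C})$ in the norm induced by $\langle f,h\rangle_{H^1}=\int_\Omega f\bar h\,dx+\int_\Omega\nabla f\cdot\nabla\bar h\,dx$. The sign convention is that $-\Delta$ has positive eigenvalues. A weak solution is a function $u\in H_0^1(\Omega)$ such that $\int_\Omega \nabla u\cdot\nabla v\,dx+\int_\Omega F(u)\,v\,dx=\int_\Omega f\,v\,dx$ for all $v\in H_0^1(\Omega)$. *)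

theory Defs
  imports "HOL-Analysis.Analysis"
begin

text \<open>
  Functions on an open set \<open>\<Omega>\<close> of $\mathbb{R}^n$ are represented by total functions on
  \<open>real ^ 'n\<close> of which only the values on \<open>\<Omega>\<close> matter; elements of function spaces are
  representatives, to be identified when they agree almost everywhere on \<open>\<Omega>\<close>.
\<close>

definition partial_deriv :: "'n \<Rightarrow> (real ^ 'n \<Rightarrow> 'b::real_normed_vector) \<Rightarrow> real ^ 'n \<Rightarrow> 'b" where
  "partial_deriv i \<phi> x = frechet_derivative \<phi> (at x) (axis i 1)"

definition gradient :: "(real ^ 'n \<Rightarrow> 'b::real_normed_vector) \<Rightarrow> real ^ 'n \<Rightarrow> 'b ^ 'n" where
  "gradient \<phi> x = (\<chi> i. partial_deriv i \<phi> x)"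

text \<open>Functions of class $C^k$ on the whole space.\<close>

primrec C_k :: "nat \<Rightarrow> (real ^ 'n \<Rightarrow> 'b::real_normed_vector) \<Rightarrow> bool" where
  "C_k 0 \<phi> \<longleftrightarrow> continuous_on UNIV \<phi>"
| "C_k (Suc k) \<phi> \<longleftrightarrow> (\<forall>x. \<phi> differentiable (at x)) \<and> (\<forall>i. C_k k (partial_deriv i \<phi>))"

text \<open>The elements of $C_c^\infty(\Omega,\mathbb{C})$, extended by zero to the whole space.\<close>

definition test_fun :: "(real ^ 'n) set \<Rightarrow> (real ^ 'n \<Rightarrow> complex) \<Rightarrow> bool" where
  "test_fun \<Omega> \<phi> \<longleftrightarrow>
     (\<forall>k. C_k k \<phi>) \<and> (\<exists>K. compact K \<and> K \<subseteq> \<Omega> \<and> (\<forall>x. x \<notin> K \<longrightarrow> \<phi> x = 0))"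

definition L2 :: "(real ^ 'n) set \<Rightarrow> (real ^ 'n \<Rightarrow> 'b::euclidean_space) set" where
  "L2 \<Omega> = {u. u \<in> borel_measurable (lebesgue_on \<Omega>) \<and>
              integrable (lebesgue_on \<Omega>) (\<lambda>x. (norm (u x))\<^sup>2)}"

text \<open>
  The completion of $C_c^\infty(\Omega)$ in the $H^1$ norm is isometric to the closure of the set of
  pairs \<open>(\<phi>, \<nabla>\<phi>)\<close> in $L^2(\Omega) \times L^2(\Omega)^n$.  The predicate says that \<open>(u, G)\<close> belongs
  to this closure, that is, that \<open>u\<close> is in $H^1_0(\Omega)$ and has gradient \<open>G\<close>.  Integration by parts
  against test functions shows that \<open>G\<close> is determined by \<open>u\<close> almost everywhere on \<open>\<Omega>\<close>.
\<close>

definition has_H01_gradient ::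
  "(real ^ 'n) set \<Rightarrow> (real ^ 'n \<Rightarrow> complex) \<Rightarrow> (real ^ 'n \<Rightarrow> complex ^ 'n) \<Rightarrow> bool" where
  "has_H01_gradient \<Omega> u G \<longleftrightarrow> u \<in> L2 \<Omega> \<and> G \<in> L2 \<Omega> \<and>
     (\<exists>\<phi>. (\<forall>k. test_fun \<Omega> (\<phi> k)) \<and>
        (\<lambda>k. (LINT x|lebesgue_on \<Omega>. (norm (\<phi> k x - u x))\<^sup>2) +
             (LINT x|lebesgue_on \<Omega>. (norm (gradient (\<phi> k) x - G x))\<^sup>2)) \<longlonglongrightarrow> 0)"

definition H01 :: "(real ^ 'n) set \<Rightarrow> (real ^ 'n \<Rightarrow> complex) set" where
  "H01 \<Omega> = {u. \<exists>G. has_H01_gradient \<Omega> u G}"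

text \<open>The bilinear dot product: no complex conjugation, unlike for an inner product.\<close>

definition cdot :: "complex ^ 'n \<Rightarrow> complex ^ 'n \<Rightarrow> complex" where
  "cdot a b = (\<Sum>i\<in>UNIV. a $ i * b $ i)"

definition weak_solution ::
  "(real ^ 'n) set \<Rightarrow> (complex \<Rightarrow> complex) \<Rightarrow> (real ^ 'n \<Rightarrow> complex) \<Rightarrow> (real ^ 'n \<Rightarrow> complex) \<Rightarrow> bool"
  where
  "weak_solution \<Omega> F f u \<longleftrightarrow>
     (\<exists>Du. has_H01_gradient \<Omega> u Du \<and>
       (\<forall>v Dv. has_H01_gradient \<Omega> v Dv \<longrightarrow>
          (LINT x|lebesgue_on \<Omega>. cdot (Du x) (Dv x)) + (LINT x|lebesgue_on \<Omega>. F (u x) * v x)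
          = (LINT x|lebesgue_on \<Omega>. f x * v x)))"

text \<open>
  Eigenvalues of $-\Delta$ on $H^1_0(\Omega)$, in the weak sense.  They are all real because
  $-\Delta$ is symmetric.
\<close>

definition dirichlet_eigenvalue :: "(real ^ 'n) set \<Rightarrow> real \<Rightarrow> bool" where
  "dirichlet_eigenvalue \<Omega> \<mu> \<longleftrightarrow>
     (\<exists>u Du. has_H01_gradient \<Omega> u Du \<and> \<not> (AE x in lebesgue_on \<Omega>. u x = 0) \<and>
       (\<forall>v Dv. has_H01_gradient \<Omega> v Dv \<longrightarrow>
          (LINT x|lebesgue_on \<Omega>. cdot (Du x) (Dv x))
          = complex_of_real \<mu> * (LINT x|lebesgue_on \<Omega>. u x * v x)))"

definition smallest_dirichlet_eigenvalue :: "(real ^ 'n) set \<Rightarrow> real \<Rightarrow> bool" where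
  "smallest_dirichlet_eigenvalue \<Omega> \<mu> \<longleftrightarrow>
     dirichlet_eigenvalue \<Omega> \<mu> \<and> (\<forall>\<nu>. dirichlet_eigenvalue \<Omega> \<nu> \<longrightarrow> \<mu> \<le> \<nu>)"

text \<open>
  Near each boundary point, \<open>\<Omega>\<close> is the region above the graph of a $C^1$ function, in orthonormal
  coordinates whose last axis points in the direction \<open>e\<close>.  A function of the other $n - 1$
  coordinates is encoded as a function on the whole space that is constant in the direction \<open>e\<close>.
\<close>

definition C1_boundary :: "(real ^ 'n) set \<Rightarrow> bool" where
  "C1_boundary \<Omega> \<longleftrightarrow>
     (\<forall>p \<in> frontier \<Omega>. \<exists>r > 0. \<exists>e. \<exists>\<gamma> :: real ^ 'n \<Rightarrow> real.
        norm e = 1 \<and> C_k 1 \<gamma> \<and> (\<forall>x t. \<gamma> (x + t *\<^sub>R e) = \<gamma> x) \<and>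
        \<Omega> \<inter> ball p r = {x \<in> ball p r. \<gamma> x < x \<bullet> e})"

end

theory Submission
  imports Defs "HOL-Complex_Analysis.Great_Picard" "HOL-Library.Diagonal_Subsequence"
begin

text \<open>
  Write \<open>U = (u, \<nabla>u)\<close>, so that $H^1_0(\Omega)$ is the closure in $L^2$ of the pairs
  \<open>(\<phi>, \<nabla>\<phi>)\<close> with \<open>\<phi>\<close> a test function.  For \<open>g\<close> in $L^2$, the linear problem
  $-\Delta u = f - F(g)$ has a unique weak solution (minimise the Dirichlet energy; the parallelogram
  law makes a minimising sequence Cauchy).  The map \<open>g \<mapsto> u\<close> is Lipschitz on $L^2$ with constant
  $C_1 C^2 < 1$, and its fixed point is the required solution.

  The estimate needs the Poincare inequality with constant \<open>C\<close>, whereas \<open>\<lambda>\<^sub>1\<close> is only given as the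
  smallest eigenvalue.  Hence the infimum of the Rayleigh quotient has to be an eigenvalue, for
  which a minimiser is obtained from Rellich compactness: averages of functions over a
  ball of radius \<open>h\<close> are equi-Lipschitz and within \<open>h * \<parallel>\<nabla>\<phi>\<parallel>\<close> of \<open>\<phi>\<close>, both by the translation estimate
  \<open>\<parallel>\<phi>(\<cdot> + z) - \<phi>\<parallel> \<le> \<bar>z\<bar> * \<parallel>\<nabla>\<phi>\<parallel>\<close>, so that the Arzela-Ascoli theorem applies to them.
\<close>

section \<open>Square-integrable functions\<close>

text \<open>\<open>F\<close> need be neither monotone nor a gradient, so the nonlinear equation need
  not have an energy to minimise; freezing the nonlinearity at \<open>g\<close> produces a linear
  problem that has one. The factor \<open>C^2\<close> in the contraction constant is the Poincare
  inequality used twice: once on the test function, once to return from the gradient of a difference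
  to its values.

  All minimisation takes place over the real scalars. The complex, unconjugated weak form is
  recovered because complex conjugation and multiplication by the imaginary unit are real-linear
  maps that preserve test functions.

  Of the spectrum only this is used: the infimum of the Rayleigh quotient is some eigenvalue, hence
  at least \<open>lambda1\<close>. Compactness is proved for test functions, which extend by zero to
  the whole space and can be translated there; so the minimising sequences for the quotient consist
  of test functions, and the minimiser lies in their closure.

  Functions are representatives, not classes. The iteration therefore yields a fixed point only
  almost everywhere, and a final change of representative is part of the argument.\<close>

definition l2 :: "'a measure \<Rightarrow> ('a \<Rightarrow> 'b::euclidean_space) set" where
  "l2 M = {u \<in> borel_measurable M. integrable M (\<lambda>x. (norm (u x))\<^sup>2)}"

definition l2norm :: "'a measure \<Rightarrow> ('a \<Rightarrow> 'b::euclidean_space) \<Rightarrow> real" where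
  "l2norm M u = sqrt (LINT x|M. (norm (u x))\<^sup>2)"

lemma l2_measurable: "u \<in> l2 M \<Longrightarrow> u \<in> borel_measurable M"
  and l2_integrable: "u \<in> l2 M \<Longrightarrow> integrable M (\<lambda>x. (norm (u x))\<^sup>2)"
  by (auto simp: l2_def)

lemma l2_dominated:
  fixes v :: "'a \<Rightarrow> 'b::euclidean_space"
  assumes "v \<in> borel_measurable M" "integrable M g" "AE x in M. (norm (v x))\<^sup>2 \<le> g x"
  shows "v \<in> l2 M"
  using assms unfolding l2_def
  by (auto intro!: Bochner_Integration.integrable_bound[OF assms(2)])

lemma l2_add:
  assumes "u \<in> l2 M" "v \<in> l2 M"
  shows "(\<lambda>x. u x + v x) \<in> l2 M"
proof (rule l2_dominated)
  show "(\<lambda>x. u x + v x) \<in> borel_measurable M"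
    using assms by (auto simp: l2_def)
  show "integrable M (\<lambda>x. 2 * (norm (u x))\<^sup>2 + 2 * (norm (v x))\<^sup>2)"
    using assms by (auto simp: l2_def)
  have "(norm (a + b))\<^sup>2 \<le> 2 * (norm a)\<^sup>2 + 2 * (norm b)\<^sup>2" for a b :: 'b
  proof -
    have "(norm (a + b))\<^sup>2 + (norm (a - b))\<^sup>2 = 2 * (norm a)\<^sup>2 + 2 * (norm b)\<^sup>2"
      by (simp add: power2_norm_eq_inner inner_add_left inner_add_right inner_diff_left
          inner_diff_right inner_commute)
    then show ?thesis
      by (smt (verit) zero_le_power2)
  qed
  then show "AE x in M. (norm (u x + v x))\<^sup>2 \<le> 2 * (norm (u x))\<^sup>2 + 2 * (norm (v x))\<^sup>2"
    by simp
qed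

lemma l2_bounded_linear:
  assumes "bounded_linear T" "u \<in> l2 M"
  shows "(\<lambda>x. T (u x)) \<in> l2 M"
proof -
  obtain K where K: "\<And>x. norm (T x) \<le> norm x * K"
    using bounded_linear.bounded[OF assms(1)] by blast
  have "T \<in> borel_measurable borel"
    using assms(1) by (intro borel_measurable_continuous_onI linear_continuous_on)
  then have "(\<lambda>x. T (u x)) \<in> borel_measurable M"
    using l2_measurable[OF assms(2)] by simp
  moreover have "(norm (T a))\<^sup>2 \<le> K\<^sup>2 * (norm a)\<^sup>2" for a
    using power_mono[OF K, of a 2] by (simp add: power_mult_distrib mult.commute)
  ultimately show ?thesis
    using l2_integrable[OF assms(2)]
    by (intro l2_dominated[where g = "\<lambda>x. K\<^sup>2 * (norm (u x))\<^sup>2"]) auto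
qed

lemmas l2_scaleR = l2_bounded_linear[OF bounded_linear_scaleR_right]
lemmas l2_minus = l2_bounded_linear[OF bounded_linear_minus[OF bounded_linear_ident]]
lemmas l2_fst = l2_bounded_linear[OF bounded_linear_fst]
lemmas l2_snd = l2_bounded_linear[OF bounded_linear_snd]

lemma l2_diff: "u \<in> l2 M \<Longrightarrow> v \<in> l2 M \<Longrightarrow> (\<lambda>x. u x - v x) \<in> l2 M"
  using l2_add[OF _ l2_minus, of u M v] by simp

lemma l2_Pair:
  assumes "u \<in> l2 M" "v \<in> l2 M"
  shows "(\<lambda>x. (u x, v x)) \<in> l2 M"
  using l2_measurable[OF assms(1)] l2_measurable[OF assms(2)] l2_integrable[OF assms(1)]
    l2_integrable[OF assms(2)]
  by (intro l2_dominated[where g = "\<lambda>x. (norm (u x))\<^sup>2 + (norm (v x))\<^sup>2"])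
    (auto simp: norm_prod_def)

lemma l2_const: "finite_measure M \<Longrightarrow> (\<lambda>x. c) \<in> l2 M"
  by (auto simp: l2_def finite_measure.integrable_const)

text \<open>\<open>F 0\<close> may be nonzero, so only \<open>F (u x) - F 0\<close> is dominated by
  \<open>L * norm (u x)\<close>; the remaining constant is square-integrable because the measure is
  finite.\<close>

lemma l2_lipschitz:
  fixes F :: "'b::euclidean_space \<Rightarrow> 'c::euclidean_space"
  assumes "L-lipschitz_on UNIV F" "finite_measure M" "u \<in> l2 M"
  shows "(\<lambda>x. F (u x)) \<in> l2 M"
proof -
  have "F \<in> borel_measurable borel"
    by (intro borel_measurable_continuous_onI lipschitz_on_continuous_on[OF assms(1)])
  then have m: "(\<lambda>x. F (u x) - F 0) \<in> borel_measurable M"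
    using l2_measurable[OF assms(3)] by measurable
  have "(norm (F a - F 0))\<^sup>2 \<le> L\<^sup>2 * (norm a)\<^sup>2" for a
    using power_mono[OF lipschitz_onD[OF assms(1), of a 0], of 2]
    by (simp add: dist_norm power_mult_distrib)
  then have "(\<lambda>x. F (u x) - F 0) \<in> l2 M"
    using m l2_integrable[OF assms(3)]
    by (intro l2_dominated[where g = "\<lambda>x. L\<^sup>2 * (norm (u x))\<^sup>2"]) auto
  from l2_add[OF this l2_const[OF assms(2), of "F 0"]] show ?thesis
    by simp
qed

text \<open>The product of two norms is dominated by the sum of their squares. One lemma covers
  inner products, complex products and scalar multiples.\<close>

lemma l2_integrable_bilinear:
  fixes B :: "'b::euclidean_space \<Rightarrow> 'c::euclidean_space \<Rightarrow> 'd::{banach,second_countable_topology}"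
  assumes "bounded_bilinear B" "u \<in> l2 M" "v \<in> l2 M"
    and "(\<lambda>x. B (u x) (v x)) \<in> borel_measurable M"
  shows "integrable M (\<lambda>x. B (u x) (v x))"
proof -
  obtain K where K: "\<And>a b. norm (B a b) \<le> norm a * norm b * K" "K \<ge> 0"
    using bounded_bilinear.nonneg_bounded[OF assms(1)] by blast
  have "norm (B a b) \<le> K * ((norm a)\<^sup>2 + (norm b)\<^sup>2)" for a b
  proof -
    have "2 * (norm a * norm b) \<le> (norm a)\<^sup>2 + (norm b)\<^sup>2"
      using sum_squares_bound[of "norm a" "norm b"] by (simp add: mult.assoc)
    moreover have "0 \<le> norm a * norm b"
      by simp
    ultimately have "norm a * norm b \<le> (norm a)\<^sup>2 + (norm b)\<^sup>2"
      by linarith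
    from mult_left_mono[OF this K(2)] K(1)[of a b] show ?thesis
      by (simp add: mult.commute)
  qed
  then have "norm (B a b) \<le> norm (K * ((norm a)\<^sup>2 + (norm b)\<^sup>2))" for a b
    by (rule order_trans) simp
  moreover have "integrable M (\<lambda>x. K * ((norm (u x))\<^sup>2 + (norm (v x))\<^sup>2))"
    using l2_integrable[OF assms(2)] l2_integrable[OF assms(3)] by simp
  ultimately show ?thesis
    using assms(4) by (blast intro: Bochner_Integration.integrable_bound AE_I2)
qed

lemma l2_integrable_inner:
  "u \<in> l2 M \<Longrightarrow> v \<in> l2 M \<Longrightarrow> integrable M (\<lambda>x. u x \<bullet> v x)"
  by (rule l2_integrable_bilinear[OF bounded_bilinear_inner]) (auto simp: l2_def)

section \<open>The L2 seminorm and the Cauchy-Schwarz inequality\<close>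

lemma l2norm_nonneg: "0 \<le> l2norm M u"
  by (simp add: l2norm_def)

lemma l2norm_square: "(l2norm M u)\<^sup>2 = (LINT x|M. (norm (u x))\<^sup>2)"
  by (simp add: l2norm_def)

lemma l2norm_square_inner: "(l2norm M u)\<^sup>2 = (LINT x|M. u x \<bullet> u x)"
  by (simp add: l2norm_square power2_norm_eq_inner)

lemma l2norm_square_add:
  assumes "u \<in> l2 M" "v \<in> l2 M"
  shows "(l2norm M (\<lambda>x. u x + v x))\<^sup>2
    = (l2norm M u)\<^sup>2 + 2 * (LINT x|M. u x \<bullet> v x) + (l2norm M v)\<^sup>2"
proof -
  have "(l2norm M (\<lambda>x. u x + v x))\<^sup>2 = (LINT x|M. u x \<bullet> u x + 2 * (u x \<bullet> v x) + v x \<bullet> v x)"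
    unfolding l2norm_square_inner
    by (intro Bochner_Integration.integral_cong) (auto simp: inner_add_left inner_add_right inner_commute)
  also have "\<dots> = (LINT x|M. u x \<bullet> u x) + 2 * (LINT x|M. u x \<bullet> v x) + (LINT x|M. v x \<bullet> v x)"
    using l2_integrable_inner[OF assms(1,1)] l2_integrable_inner[OF assms]
      l2_integrable_inner[OF assms(2,2)] by simp
  finally show ?thesis
    by (simp only: l2norm_square_inner)
qed

lemma l2norm_scaleR: "l2norm M (\<lambda>x. c *\<^sub>R u x) = \<bar>c\<bar> * l2norm M u"
  by (simp add: l2norm_def power_mult_distrib real_sqrt_mult)

lemma l2norm_minus_commute: "l2norm M (\<lambda>x. u x - v x) = l2norm M (\<lambda>x. v x - u x)"
  by (simp add: l2norm_def norm_minus_commute)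

lemma l2norm_square_Pair:
  assumes "U \<in> l2 M"
  shows "(l2norm M U)\<^sup>2 = (l2norm M (\<lambda>x. fst (U x)))\<^sup>2 + (l2norm M (\<lambda>x. snd (U x)))\<^sup>2"
  using l2_integrable[OF l2_fst[OF assms]] l2_integrable[OF l2_snd[OF assms]]
  by (simp add: l2norm_square norm_prod_def)

lemma l2norm_fst_le: "U \<in> l2 M \<Longrightarrow> l2norm M (\<lambda>x. fst (U x)) \<le> l2norm M U"
  and l2norm_snd_le: "U \<in> l2 M \<Longrightarrow> l2norm M (\<lambda>x. snd (U x)) \<le> l2norm M U"
  by (rule power2_le_imp_le; simp add: l2norm_square_Pair l2norm_nonneg)+

text \<open>For \<open>c > 0\<close> the bound is the value at the minimum
  \<open>t = - b / c\<close>. Besides giving Cauchy-Schwarz, this serves as the first-order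
  condition at a minimiser: with \<open>a = 0\<close> it says that a nonnegative quadratic that
  vanishes at 0 has no linear term.\<close>

lemma nonneg_quadratic_discriminant:
  fixes a b c :: real
  assumes "\<And>t. 0 \<le> a + 2 * t * b + t\<^sup>2 * c"
  shows "b\<^sup>2 \<le> a * c"
proof (cases "c = 0")
  case True
  have "b = 0"
  proof (rule ccontr)
    assume "b \<noteq> 0"
    then show False
      \<comment> \<open>The value of the expression at this \<open>t\<close> is -1.\<close>
      using assms[of "- (a + 1) / (2 * b)"] True by (simp add: field_simps)
  qed
  then show ?thesis
    using True by simp
next
  case False
  have "0 \<le> c"
  proof (rule ccontr)
    assume "\<not> 0 \<le> c"
    \<comment> \<open>\<open>t \<ge> 1\<close> gives \<open>a \<le> t * \<bar>a\<bar>\<close>, so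
      that \<open>t\<close> can be factored out; the second summand in \<open>t \<ge> 1\<close>
      aside, the quotient makes the remaining factor at most -1.\<close>
    define t where "t = (\<bar>a\<bar> + 2 * \<bar>b\<bar> + 1) / \<bar>c\<bar> + 1"
    have t: "t \<ge> 1" "\<bar>c\<bar> * t \<ge> \<bar>a\<bar> + 2 * \<bar>b\<bar> + 1"
      using False by (auto simp: t_def field_simps)
    have "a + 2 * t * b + t\<^sup>2 * c \<le> t * (\<bar>a\<bar> + 2 * \<bar>b\<bar> - \<bar>c\<bar> * t)"
    proof -
      have "a \<le> t * \<bar>a\<bar>" 
        using mult_right_mono[OF t(1), of "\<bar>a\<bar>"] by simp
      moreover have "2 * t * b \<le> 2 * t * \<bar>b\<bar>"
        using t(1) by (intro mult_left_mono) auto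
      ultimately show ?thesis
        using \<open>\<not> 0 \<le> c\<close> by (simp add: algebra_simps power2_eq_square)
    qed
    also have "\<dots> < 0"
      using t by (intro mult_pos_neg) auto
    finally show False
      using assms[of t] by simp
  qed
  with False have "0 < c"
    by simp
  have "0 \<le> a - b\<^sup>2 / c"
    using assms[of "- b / c"] \<open>0 < c\<close> by (simp add: power2_eq_square field_simps)
  then show ?thesis
    using \<open>0 < c\<close> by (simp add: field_simps)
qed

lemma l2_Cauchy_Schwarz:
  assumes "u \<in> l2 M" "v \<in> l2 M"
  shows "\<bar>LINT x|M. u x \<bullet> v x\<bar> \<le> l2norm M u * l2norm M v"
proof -
  have "0 \<le> (l2norm M u)\<^sup>2 + 2 * t * (LINT x|M. u x \<bullet> v x) + t\<^sup>2 * (l2norm M v)\<^sup>2" for t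
    using l2norm_square_add[OF assms(1) l2_scaleR[OF assms(2), of t]]
      zero_le_power2[of "l2norm M (\<lambda>x. u x + t *\<^sub>R v x)"]
    by (simp add: l2norm_scaleR power_mult_distrib)
  from nonneg_quadratic_discriminant[OF this]
  have "\<bar>LINT x|M. u x \<bullet> v x\<bar>\<^sup>2 \<le> (l2norm M u * l2norm M v)\<^sup>2"
    by (simp add: power_mult_distrib)
  then show ?thesis
    by (rule power2_le_imp_le) (simp add: l2norm_nonneg)
qed

lemma l2norm_triangle:
  assumes "u \<in> l2 M" "v \<in> l2 M"
  shows "l2norm M (\<lambda>x. u x + v x) \<le> l2norm M u + l2norm M v"
proof (rule power2_le_imp_le)
  show "(l2norm M (\<lambda>x. u x + v x))\<^sup>2 \<le> (l2norm M u + l2norm M v)\<^sup>2"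
    using l2_Cauchy_Schwarz[OF assms]
    by (simp add: l2norm_square_add[OF assms] power2_sum)
qed (simp add: l2norm_nonneg)

lemma l2norm_triangle_diff:
  assumes "u \<in> l2 M" "v \<in> l2 M" "w \<in> l2 M"
  shows "l2norm M (\<lambda>x. u x - w x) \<le> l2norm M (\<lambda>x. u x - v x) + l2norm M (\<lambda>x. v x - w x)"
  using l2norm_triangle[OF l2_diff[OF assms(1,2)] l2_diff[OF assms(2,3)]] by simp

lemma l2norm_diff_ge:
  assumes "u \<in> l2 M" "v \<in> l2 M"
  shows "\<bar>l2norm M u - l2norm M v\<bar> \<le> l2norm M (\<lambda>x. u x - v x)"
  using l2norm_triangle[OF l2_diff[OF assms] assms(2)]
    l2norm_triangle[OF l2_diff[OF assms(2,1)] assms(1)]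
  by (simp add: l2norm_minus_commute[of M v u])

lemma l2norm_eq_0_iff:
  assumes "u \<in> l2 M"
  shows "l2norm M u = 0 \<longleftrightarrow> (AE x in M. u x = 0)"
  using integral_nonneg_eq_0_iff_AE[OF l2_integrable[OF assms]] by (simp add: l2norm_def)

text \<open>Cauchy-Schwarz against the constant function whose value is the integral
  \<open>w\<close> itself: it bounds \<open>(norm w)^2\<close> by a multiple of
  \<open>norm w\<close>, and one factor cancels.\<close>

lemma l2_norm_integral_le:
  fixes u :: "'a \<Rightarrow> 'b::euclidean_space"
  assumes "finite_measure M" "u \<in> l2 M"
  shows "(norm (LINT x|M. u x))\<^sup>2 \<le> measure M (space M) * (LINT x|M. (norm (u x))\<^sup>2)"
proof -
  define w where "w = (LINT x|M. u x)"
  have "integrable M u"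
    using l2_integrable_bilinear[OF bounded_bilinear_scaleR l2_const[OF assms(1), of 1] assms(2)]
      l2_measurable[OF assms(2)] by simp
  then have "(norm w)\<^sup>2 = (LINT x|M. u x \<bullet> w)"
    by (simp add: w_def power2_norm_eq_inner)
  also have "\<dots> \<le> l2norm M u * l2norm M (\<lambda>x. w)"
    using l2_Cauchy_Schwarz[OF assms(2) l2_const[OF assms(1), of w]] by linarith
  also have "l2norm M (\<lambda>x. w) = norm w * sqrt (measure M (space M))"
    by (simp add: l2norm_def real_sqrt_mult mult.commute)
  finally have "norm w * norm w \<le> norm w * (l2norm M u * sqrt (measure M (space M)))"
    by (simp add: power2_eq_square algebra_simps)
  then have "norm w \<le> l2norm M u * sqrt (measure M (space M))"
    by (cases "norm w = 0") (auto simp: l2norm_nonneg)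
  from power_mono[OF this norm_ge_zero, of 2] show ?thesis
    by (simp add: w_def power_mult_distrib l2norm_square mult.commute)
qed

section \<open>Completeness of L2\<close>

definition l2_Cauchy :: "'a measure \<Rightarrow> (nat \<Rightarrow> 'a \<Rightarrow> 'b::euclidean_space) \<Rightarrow> bool" where
  "l2_Cauchy M U \<longleftrightarrow> (\<forall>e>0. \<exists>N. \<forall>k\<ge>N. \<forall>l\<ge>N. l2norm M (\<lambda>x. U k x - U l x) < e)"

text \<open>The weights \<open>4 ^ k\<close> turn the squared distances, at most
  \<open>(1/16) ^ k\<close>, into a summable series of integrals. At almost every point the weighted
  squares are then bounded by their finite sum \<open>c\<close>, so the increments are at most
  \<open>sqrt c * (1/2) ^ k\<close> and the telescoping series converges. Working with squares
  directly keeps the measure arbitrary.\<close>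

lemma l2_AE_convergent:
  fixes U :: "nat \<Rightarrow> 'a \<Rightarrow> 'b::euclidean_space"
  assumes U: "\<And>k. U k \<in> l2 M"
    and d: "\<And>k. l2norm M (\<lambda>x. U (Suc k) x - U k x) < (1/4) ^ k"
  shows "AE x in M. convergent (\<lambda>k. U k x)"
proof -
  define d where "d k x = norm (U (Suc k) x - U k x)" for k x
  have meas [measurable]: "d k \<in> borel_measurable M" for k
    using l2_measurable[OF U, of k] l2_measurable[OF U, of "Suc k"]
    unfolding d_def by measurable
  have int: "(\<integral>\<^sup>+x. ennreal (4 ^ k * (d k x)\<^sup>2) \<partial>M) \<le> ennreal ((1/4) ^ k)" for k
  proof -
    have "integrable M (\<lambda>x. (d k x)\<^sup>2)"
      using l2_integrable[OF l2_diff[OF U[of "Suc k"] U[of k]]] by (simp add: d_def)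
    then have "(\<integral>\<^sup>+x. ennreal (4 ^ k * (d k x)\<^sup>2) \<partial>M)
        = ennreal (4 ^ k * (l2norm M (\<lambda>x. U (Suc k) x - U k x))\<^sup>2)"
      by (subst nn_integral_eq_integral) (auto simp: l2norm_square d_def)
    also have "(l2norm M (\<lambda>x. U (Suc k) x - U k x))\<^sup>2 \<le> ((1/4) ^ k)\<^sup>2"
      using d[of k] by (intro power_mono less_imp_le l2norm_nonneg)
    then have "4 ^ k * (l2norm M (\<lambda>x. U (Suc k) x - U k x))\<^sup>2 \<le> (1/4) ^ k"
      by (auto simp: power2_eq_square power_divide field_simps)
    then have "ennreal (4 ^ k * (l2norm M (\<lambda>x. U (Suc k) x - U k x))\<^sup>2) \<le> ennreal ((1/4) ^ k)"
      by (rule ennreal_leI)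
    finally show ?thesis .
  qed
  have "(\<integral>\<^sup>+x. (\<Sum>k. ennreal (4 ^ k * (d k x)\<^sup>2)) \<partial>M)
      = (\<Sum>k. \<integral>\<^sup>+x. ennreal (4 ^ k * (d k x)\<^sup>2) \<partial>M)"
    by (intro nn_integral_suminf) measurable
  also have "\<dots> \<le> (\<Sum>k. ennreal ((1/4) ^ k))"
    by (intro suminf_le int) auto
  also have "\<dots> = ennreal (\<Sum>k. (1/4) ^ k)"
    by (intro suminf_ennreal2) (auto intro: summable_geometric)
  finally have fin: "(\<integral>\<^sup>+x. (\<Sum>k. ennreal (4 ^ k * (d k x)\<^sup>2)) \<partial>M) \<noteq> \<infinity>"
    by (rule neq_top_trans[rotated, unfolded infinity_ennreal_def[symmetric]]) simp
  have "AE x in M. (\<Sum>k. ennreal (4 ^ k * (d k x)\<^sup>2)) \<noteq> \<infinity>"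
    by (rule nn_integral_PInf_AE[OF _ fin]) measurable
  then show ?thesis
  proof eventually_elim
    case (elim x)
    then have "(\<Sum>k. ennreal (4 ^ k * (d k x)\<^sup>2)) < top"
      by (simp only: infinity_ennreal_def less_top)
    then obtain c where c: "(\<Sum>k. ennreal (4 ^ k * (d k x)\<^sup>2)) = ennreal c" "0 \<le> c"
      unfolding less_top_ennreal by blast
    have "norm (U (Suc k) x - U k x) \<le> sqrt c * (1/2) ^ k" for k
    proof -
      have "ennreal (4 ^ k * (d k x)\<^sup>2) \<le> ennreal c"
        using sum_le_suminf[of "\<lambda>k. ennreal (4 ^ k * (d k x)\<^sup>2)" "{k}"] c(1) by simp
      then have "4 ^ k * (d k x)\<^sup>2 \<le> c"
        using c(2) by (simp only: ennreal_le_iff)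
      moreover have "(4::real) ^ k = (2 ^ k)\<^sup>2"
        by (simp add: power2_eq_square flip: power_mult_distrib)
      ultimately have "(2 ^ k * d k x)\<^sup>2 \<le> c"
        by (simp only: power_mult_distrib)
      then have "2 ^ k * d k x \<le> sqrt c"
        by (rule real_le_rsqrt)
      then have "d k x \<le> sqrt c / 2 ^ k"
        by (simp add: pos_le_divide_eq mult.commute)
      then show ?thesis
        by (simp add: d_def power_divide)
    qed
    then have "summable (\<lambda>k. U (Suc k) x - U k x)"
      by (rule summable_comparison_test'[rotated]) (intro summable_mult summable_geometric, simp)
    then have "convergent (\<lambda>n. \<Sum>k<n. U (Suc k) x - U k x)"
      by (simp add: summable_iff_convergent)
    then have "convergent (\<lambda>n. (U n x - U 0 x) + U 0 x)"
      by (intro convergent_add convergent_const) (simp add: sum_lessThan_telescope[of "\<lambda>k. U k x"])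
    then show ?case
      by simp
  qed
qed

lemma l2_complete:
  fixes U :: "nat \<Rightarrow> 'a \<Rightarrow> 'b::euclidean_space"
  assumes U: "\<And>k. U k \<in> l2 M" and "l2_Cauchy M U"
  obtains L where "L \<in> l2 M" "(\<lambda>k. l2norm M (\<lambda>x. U k x - L x)) \<longlonglongrightarrow> 0"
proof -
  have "\<exists>N. \<forall>k\<ge>N. \<forall>l\<ge>N. l2norm M (\<lambda>x. U k x - U l x) < (1/4) ^ j" for j
    using assms(2) unfolding l2_Cauchy_def by simp
  then obtain N where N: "\<And>j k l. k \<ge> N j \<Longrightarrow> l \<ge> N j \<Longrightarrow> l2norm M (\<lambda>x. U k x - U l x) < (1/4) ^ j"
    by metis
  \<comment> \<open>\<open>N\<close> need not be monotone. The sum makes both \<open>r j\<close> and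
    \<open>r (Suc j)\<close> at least \<open>N j\<close>, and the added \<open>j\<close> makes
    \<open>r\<close> tend to infinity.\<close>
  define r where "r j = (\<Sum>i\<le>j. N i) + j" for j
  have r: "r j \<ge> N j" "r j \<ge> j" "r (Suc j) \<ge> N j" for j
    using member_le_sum[of j "{..j}" N] member_le_sum[of j "{..Suc j}" N] by (auto simp: r_def)
  have conv: "AE x in M. convergent (\<lambda>j. U (r j) x)"
    using N r by (intro l2_AE_convergent U) auto
  \<comment> \<open>Where the subsequence diverges, \<open>lim\<close> returns a fixed unspecified
    value, which leaves \<open>L\<close> measurable.\<close>
  define L where "L x = lim (\<lambda>j. U (r j) x)" for x
  have L_meas [measurable]: "L \<in> borel_measurable M"
    unfolding L_def using l2_measurable[OF U] by measurable
  have U_meas [measurable]: "U k \<in> borel_measurable M" for k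
    using l2_measurable[OF U] .
  have AE_lim: "AE x in M. (\<lambda>j. U (r j) x) \<longlonglongrightarrow> L x"
    using conv by eventually_elim (simp add: L_def convergent_LIMSEQ_iff)
  \<comment> \<open>Fatou's lemma lets \<open>i\<close> tend to infinity in the Cauchy estimate for
    \<open>U k\<close> and \<open>U (r i)\<close>. The bound concerns a nonnegative integral because
    \<open>L\<close> is not yet known to be square-integrable.\<close>
  have bound: "(\<integral>\<^sup>+x. ennreal ((norm (U k x - L x))\<^sup>2) \<partial>M) \<le> ennreal (((1/4) ^ j)\<^sup>2)"
    if "k \<ge> N j" for k j
  proof -
    have "(\<integral>\<^sup>+x. ennreal ((norm (U k x - L x))\<^sup>2) \<partial>M)
        = (\<integral>\<^sup>+x. liminf (\<lambda>i. ennreal ((norm (U k x - U (r i) x))\<^sup>2)) \<partial>M)"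
    proof (rule nn_integral_cong_AE)
      show "AE x in M. ennreal ((norm (U k x - L x))\<^sup>2)
          = liminf (\<lambda>i. ennreal ((norm (U k x - U (r i) x))\<^sup>2))"
        using AE_lim
      proof eventually_elim
        case (elim x)
        then have "(\<lambda>i. ennreal ((norm (U k x - U (r i) x))\<^sup>2)) \<longlonglongrightarrow> ennreal ((norm (U k x - L x))\<^sup>2)"
          by (intro tendsto_intros)
        then show ?case
          by (rule lim_imp_Liminf[OF sequentially_bot, symmetric])
      qed
    qed
    also have "\<dots> \<le> liminf (\<lambda>i. \<integral>\<^sup>+x. ennreal ((norm (U k x - U (r i) x))\<^sup>2) \<partial>M)"
      by (intro nn_integral_liminf) measurable
    also have "\<dots> \<le> ennreal (((1/4) ^ j)\<^sup>2)"
    proof (rule Liminf_le)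
      have "(\<integral>\<^sup>+x. ennreal ((norm (U k x - U (r i) x))\<^sup>2) \<partial>M) \<le> ennreal (((1/4) ^ j)\<^sup>2)"
        if "i \<ge> N j" for i
      proof -
        have "(\<integral>\<^sup>+x. ennreal ((norm (U k x - U (r i) x))\<^sup>2) \<partial>M)
            = ennreal ((l2norm M (\<lambda>x. U k x - U (r i) x))\<^sup>2)"
          unfolding l2norm_square
          by (intro nn_integral_eq_integral l2_integrable l2_diff U) auto
        also have "\<dots> \<le> ennreal (((1/4) ^ j)\<^sup>2)"
          using N[OF \<open>k \<ge> N j\<close>, of "r i"] r(2)[of i] that
          by (intro ennreal_leI power_mono l2norm_nonneg) auto
        finally show ?thesis .
      qed
      then show "\<forall>\<^sub>F i in sequentially.
          (\<integral>\<^sup>+x. ennreal ((norm (U k x - U (r i) x))\<^sup>2) \<partial>M) \<le> ennreal (((1/4) ^ j)\<^sup>2)"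
        by (auto simp: eventually_sequentially)
    qed simp
    finally show ?thesis .
  qed
  have diff: "(\<lambda>x. U k x - L x) \<in> l2 M" if "k \<ge> N j" for k j
    using bound[OF that]
    by (auto simp: l2_def integrable_iff_bounded intro: le_less_trans)
  have "(\<lambda>x. U (N 0) x - (U (N 0) x - L x)) \<in> l2 M"
    by (intro l2_diff U diff[of 0]) simp
  then have L: "L \<in> l2 M"
    by simp
  moreover have "(\<lambda>k. l2norm M (\<lambda>x. U k x - L x)) \<longlonglongrightarrow> 0"
  proof (rule LIMSEQ_I)
    fix e :: real
    assume "0 < e"
    then obtain j where j: "(1/4) ^ j < e"
      using real_arch_pow_inv[of e "1/4"] by auto
    have "l2norm M (\<lambda>x. U k x - L x) < e" if "k \<ge> N j" for k
    proof -
      have "ennreal ((l2norm M (\<lambda>x. U k x - L x))\<^sup>2) \<le> ennreal (((1/4) ^ j)\<^sup>2)"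
        using bound[OF that] l2_integrable[OF diff[OF that]]
        by (simp add: l2norm_square nn_integral_eq_integral)
      then have "(l2norm M (\<lambda>x. U k x - L x))\<^sup>2 \<le> ((1/4) ^ j)\<^sup>2"
        by (subst (asm) ennreal_le_iff) auto
      then have "l2norm M (\<lambda>x. U k x - L x) \<le> (1/4) ^ j"
        by (rule power2_le_imp_le) simp
      with j show ?thesis
        by simp
    qed
    then show "\<exists>no. \<forall>n\<ge>no. norm (l2norm M (\<lambda>x. U n x - L x) - 0) < e"
      by (auto simp: l2norm_nonneg)
  qed
  ultimately show ?thesis
    using that by blast
qed

lemma l2_tendsto_inner:
  assumes "\<And>k. U k \<in> l2 M" "L \<in> l2 M" "(\<lambda>k. l2norm M (\<lambda>x. U k x - L x)) \<longlonglongrightarrow> 0" "V \<in> l2 M"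
  shows "(\<lambda>k. LINT x|M. U k x \<bullet> V x) \<longlonglongrightarrow> (LINT x|M. L x \<bullet> V x)"
proof (rule LIM_zero_cancel, rule tendsto_rabs_zero_cancel, rule tendsto_0_le)
  show "(\<lambda>k. l2norm M (\<lambda>x. U k x - L x)) \<longlonglongrightarrow> 0"
    by (rule assms(3))
  have "\<bar>(LINT x|M. U k x \<bullet> V x) - (LINT x|M. L x \<bullet> V x)\<bar>
      \<le> l2norm M (\<lambda>x. U k x - L x) * l2norm M V" for k
  proof -
    have "(LINT x|M. U k x \<bullet> V x) - (LINT x|M. L x \<bullet> V x) = (LINT x|M. (U k x - L x) \<bullet> V x)"
      using l2_integrable_inner[OF assms(1,4)] l2_integrable_inner[OF assms(2,4)]
      by (simp add: inner_diff_left)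
    then show ?thesis
      using l2_Cauchy_Schwarz[OF l2_diff[OF assms(1,2)] assms(4)] by (simp only:)
  qed
  then show "\<forall>\<^sub>F k in sequentially. norm \<bar>(LINT x|M. U k x \<bullet> V x) - (LINT x|M. L x \<bullet> V x)\<bar>
      \<le> norm (l2norm M (\<lambda>x. U k x - L x)) * l2norm M V"
    by (simp add: l2norm_nonneg)
qed

lemma l2norm_tendsto:
  assumes "\<And>k. U k \<in> l2 M" "L \<in> l2 M" "(\<lambda>k. l2norm M (\<lambda>x. U k x - L x)) \<longlonglongrightarrow> 0"
  shows "(\<lambda>k. l2norm M (U k)) \<longlonglongrightarrow> l2norm M L"
proof (rule LIM_zero_cancel, rule tendsto_0_le[OF assms(3), where K = 1], rule always_eventually, rule allI)
  show "norm (l2norm M (U k) - l2norm M L) \<le> norm (l2norm M (\<lambda>x. U k x - L x)) * 1" for k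
    using l2norm_diff_ge[OF assms(1,2), of k] by (simp add: l2norm_nonneg)
qed

section \<open>Convergence, subspaces and closures in L2\<close>

definition l2_lim :: "'a measure \<Rightarrow> (nat \<Rightarrow> 'a \<Rightarrow> 'b::euclidean_space) \<Rightarrow> ('a \<Rightarrow> 'b) \<Rightarrow> bool" where
  "l2_lim M U L \<longleftrightarrow> (\<lambda>k. l2norm M (\<lambda>x. U k x - L x)) \<longlonglongrightarrow> 0"

lemma l2_limI:
  assumes "\<And>k. l2norm M (\<lambda>x. U k x - L x) \<le> g k" "g \<longlonglongrightarrow> 0"
  shows "l2_lim M U L"
  unfolding l2_lim_def
  by (rule Lim_null_comparison[OF _ assms(2)]) (use assms(1) in \<open>simp add: l2norm_nonneg\<close>)

lemma l2_lim_add: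
  assumes "\<And>k. U k \<in> l2 M" "L \<in> l2 M" "\<And>k. V k \<in> l2 M" "K \<in> l2 M"
    and "l2_lim M U L" "l2_lim M V K"
  shows "l2_lim M (\<lambda>k x. U k x + V k x) (\<lambda>x. L x + K x)"
proof (rule l2_limI)
  fix k
  have "(\<lambda>x. U k x + V k x - (L x + K x)) = (\<lambda>x. (U k x - L x) + (V k x - K x))"
    by (simp add: algebra_simps)
  then show "l2norm M (\<lambda>x. U k x + V k x - (L x + K x))
      \<le> l2norm M (\<lambda>x. U k x - L x) + l2norm M (\<lambda>x. V k x - K x)"
    using l2norm_triangle[OF l2_diff[OF assms(1,2)] l2_diff[OF assms(3,4)], of k k]
    by (simp only:)
next
  show "(\<lambda>k. l2norm M (\<lambda>x. U k x - L x) + l2norm M (\<lambda>x. V k x - K x)) \<longlonglongrightarrow> 0"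
    using assms(5,6) tendsto_add[of _ 0 _ _ 0] unfolding l2_lim_def by force
qed

lemma l2_lim_scaleR:
  assumes "l2_lim M U L"
  shows "l2_lim M (\<lambda>k x. c *\<^sub>R U k x) (\<lambda>x. c *\<^sub>R L x)"
proof -
  have "(\<lambda>k. \<bar>c\<bar> * l2norm M (\<lambda>x. U k x - L x)) \<longlonglongrightarrow> 0"
    using assms unfolding l2_lim_def by (rule tendsto_mult_right_zero)
  then show ?thesis
    by (simp add: l2_lim_def l2norm_scaleR flip: scaleR_diff_right)
qed

lemma l2_lim_fst:
  assumes "\<And>k. U k \<in> l2 M" "L \<in> l2 M" "l2_lim M U L"
  shows "l2_lim M (\<lambda>k x. fst (U k x)) (\<lambda>x. fst (L x))"
  using l2norm_fst_le[OF l2_diff[OF assms(1,2)]] assms(3)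
  by (intro l2_limI[where g = "\<lambda>k. l2norm M (\<lambda>x. U k x - L x)"]) (simp_all add: l2_lim_def)

lemma l2_lim_snd:
  assumes "\<And>k. U k \<in> l2 M" "L \<in> l2 M" "l2_lim M U L"
  shows "l2_lim M (\<lambda>k x. snd (U k x)) (\<lambda>x. snd (L x))"
  using l2norm_snd_le[OF l2_diff[OF assms(1,2)]] assms(3)
  by (intro l2_limI[where g = "\<lambda>k. l2norm M (\<lambda>x. U k x - L x)"]) (simp_all add: l2_lim_def)

text \<open>The scalars are real; invariance under the imaginary unit is supplied separately by
  \<open>has_H01_gradient_linear\<close>. Closedness is not part of the notion, so that pairs of
  test functions and their gradients qualify.\<close>

definition l2_subspace :: "'a measure \<Rightarrow> ('a \<Rightarrow> 'b::euclidean_space) set \<Rightarrow> bool" where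
  "l2_subspace M W \<longleftrightarrow> W \<subseteq> l2 M \<and> (\<lambda>x. 0) \<in> W \<and>
     (\<forall>u\<in>W. \<forall>v\<in>W. (\<lambda>x. u x + v x) \<in> W) \<and> (\<forall>c. \<forall>u\<in>W. (\<lambda>x. c *\<^sub>R u x) \<in> W)"

lemma
  assumes "l2_subspace M W"
  shows l2_subspace_l2: "u \<in> W \<Longrightarrow> u \<in> l2 M"
    and l2_subspace_0: "(\<lambda>x. 0) \<in> W"
    and l2_subspace_add: "u \<in> W \<Longrightarrow> v \<in> W \<Longrightarrow> (\<lambda>x. u x + v x) \<in> W"
    and l2_subspace_scaleR: "u \<in> W \<Longrightarrow> (\<lambda>x. c *\<^sub>R u x) \<in> W"
  using assms unfolding l2_subspace_def by blast+

lemma l2_subspace_diff: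
  assumes "l2_subspace M W" "u \<in> W" "v \<in> W"
  shows "(\<lambda>x. u x - v x) \<in> W"
  using l2_subspace_add[OF assms(1,2) l2_subspace_scaleR[OF assms(1,3), of "-1"]] by simp

definition l2_closure :: "'a measure \<Rightarrow> ('a \<Rightarrow> 'b::euclidean_space) set \<Rightarrow> ('a \<Rightarrow> 'b) set" where
  "l2_closure M D = {U \<in> l2 M. \<exists>\<Phi>. (\<forall>k. \<Phi> k \<in> D) \<and> l2_lim M \<Phi> U}"

lemma l2_closureI:
  "U \<in> l2 M \<Longrightarrow> (\<And>k. \<Phi> k \<in> D) \<Longrightarrow> l2_lim M \<Phi> U \<Longrightarrow> U \<in> l2_closure M D"
  unfolding l2_closure_def by blast

lemma l2_closureE:
  assumes "U \<in> l2_closure M D"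
  obtains \<Phi> where "\<And>k. \<Phi> k \<in> D" "l2_lim M \<Phi> U" "U \<in> l2 M"
  using assms unfolding l2_closure_def by blast

lemma l2_closure_superset:
  assumes "l2_subspace M D"
  shows "D \<subseteq> l2_closure M D"
proof
  fix U
  assume U: "U \<in> D"
  have "l2_lim M (\<lambda>_. U) U"
    by (simp add: l2_lim_def l2norm_def)
  then show "U \<in> l2_closure M D"
    by (rule l2_closureI[OF l2_subspace_l2[OF assms U] U])
qed

lemma l2_subspace_closure:
  assumes D: "l2_subspace M D"
  shows "l2_subspace M (l2_closure M D)"
  unfolding l2_subspace_def
proof (intro conjI ballI allI)
  show "l2_closure M D \<subseteq> l2 M"
    by (auto simp: l2_closure_def)
  show "(\<lambda>x. 0) \<in> l2_closure M D"
    using l2_closure_superset[OF D] l2_subspace_0[OF D] by blast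
next
  fix u v
  assume "u \<in> l2_closure M D" "v \<in> l2_closure M D"
  then obtain \<Phi> \<Psi> where *: "\<And>k. \<Phi> k \<in> D" "l2_lim M \<Phi> u" "u \<in> l2 M"
      "\<And>k. \<Psi> k \<in> D" "l2_lim M \<Psi> v" "v \<in> l2 M"
    by (elim l2_closureE) metis
  have "l2_lim M (\<lambda>k x. \<Phi> k x + \<Psi> k x) (\<lambda>x. u x + v x)"
    by (rule l2_lim_add[OF l2_subspace_l2[OF D *(1)] *(3) l2_subspace_l2[OF D *(4)] *(6,2,5)])
  then show "(\<lambda>x. u x + v x) \<in> l2_closure M D"
    by (rule l2_closureI[OF l2_add[OF *(3,6)] l2_subspace_add[OF D *(1,4)]])
next
  fix c :: real and u
  assume "u \<in> l2_closure M D"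
  then obtain \<Phi> where *: "\<And>k. \<Phi> k \<in> D" "l2_lim M \<Phi> u" "u \<in> l2 M"
    by (elim l2_closureE) metis
  show "(\<lambda>x. c *\<^sub>R u x) \<in> l2_closure M D"
    by (rule l2_closureI[OF l2_scaleR[OF *(3)] l2_subspace_scaleR[OF D *(1)] l2_lim_scaleR[OF *(2)]])
qed

text \<open>\<open>l2_closure\<close> collects limits of sequences from \<open>D\<close>, so limits
  of its own elements have to be reached from \<open>D\<close> again. An element of \<open>D\<close>
  within \<open>1 / (k + 1)\<close> of \<open>U k\<close> is chosen for each \<open>k\<close>; these
  approximants have the same limit as \<open>U\<close>.\<close>

lemma l2_closure_complete:
  assumes D: "l2_subspace M D" and U: "\<And>k. U k \<in> l2_closure M D" and "l2_Cauchy M U"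
  obtains L where "L \<in> l2_closure M D" "l2_lim M U L"
proof -
  note Ul2 = l2_subspace_l2[OF l2_subspace_closure[OF D] U]
  obtain L where L: "L \<in> l2 M" "l2_lim M U L"
    using l2_complete[OF Ul2 assms(3)] unfolding l2_lim_def by blast
  have "\<exists>\<phi>. \<phi> \<in> D \<and> l2norm M (\<lambda>x. \<phi> x - U k x) < inverse (real (Suc k))" for k
  proof -
    obtain \<Phi> where \<Phi>: "\<And>j. \<Phi> j \<in> D" "l2_lim M \<Phi> (U k)"
      using l2_closureE[OF U[of k]] by metis
    have "0 < inverse (real (Suc k))"
      by simp
    from LIMSEQ_D[OF \<Phi>(2)[unfolded l2_lim_def] this]
    obtain N where "norm (l2norm M (\<lambda>x. \<Phi> N x - U k x) - 0) < inverse (real (Suc k))"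
      by blast
    then show ?thesis
      by (intro exI[of _ "\<Phi> N"] conjI \<Phi>(1)) (simp add: l2norm_nonneg)
  qed
  then obtain \<Phi> where \<Phi>: "\<And>k. \<Phi> k \<in> D" "\<And>k. l2norm M (\<lambda>x. \<Phi> k x - U k x) < inverse (real (Suc k))"
    by metis
  have "l2_lim M \<Phi> L"
  proof (rule l2_limI)
    show "l2norm M (\<lambda>x. \<Phi> k x - L x) \<le> inverse (real (Suc k)) + l2norm M (\<lambda>x. U k x - L x)" for k
      using l2norm_triangle_diff[OF l2_subspace_l2[OF D \<Phi>(1)] Ul2 L(1), of k k] \<Phi>(2)[of k] by linarith
    show "(\<lambda>k. inverse (real (Suc k)) + l2norm M (\<lambda>x. U k x - L x)) \<longlonglongrightarrow> 0"
      using tendsto_add[OF LIMSEQ_inverse_real_of_nat L(2)[unfolded l2_lim_def]] by simp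
  qed
  with L(1) \<Phi>(1) have "L \<in> l2_closure M D"
    by (rule l2_closureI)
  then show ?thesis
    using L(2) by (rule that)
qed

lemma l2norm_parallelogram:
  assumes "u \<in> l2 M" "v \<in> l2 M"
  shows "(l2norm M (\<lambda>x. u x - v x))\<^sup>2
    = 2 * (l2norm M u)\<^sup>2 + 2 * (l2norm M v)\<^sup>2 - (l2norm M (\<lambda>x. u x + v x))\<^sup>2"
proof -
  have "(l2norm M (\<lambda>x. u x + - v x))\<^sup>2 = (l2norm M u)\<^sup>2 + 2 * (LINT x|M. u x \<bullet> - v x) + (l2norm M (\<lambda>x. - v x))\<^sup>2"
    by (rule l2norm_square_add[OF assms(1) l2_minus[OF assms(2)]])
  moreover have "l2norm M (\<lambda>x. - v x) = l2norm M v"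
    by (simp add: l2norm_def)
  ultimately show ?thesis
    using l2norm_square_add[OF assms] by simp
qed

lemma l2_CauchyI_square:
  assumes "\<And>k l. (l2norm M (\<lambda>x. U k x - U l x))\<^sup>2 \<le> K * (\<delta> k + \<delta> l)" "\<delta> \<longlonglongrightarrow> 0" "0 \<le> K"
  shows "l2_Cauchy M U"
  unfolding l2_Cauchy_def
proof (intro allI impI)
  fix e :: real
  assume "0 < e"
  \<comment> \<open>With \<open>K + 1\<close> in the denominator the case \<open>K = 0\<close> is
    covered, and \<open>2 * K * q\<close> stays strictly below \<open>e^2\<close>.\<close>
  define q where "q = e\<^sup>2 / (2 * (K + 1))"
  have "0 < q"
    using assms(3) \<open>0 < e\<close> by (simp add: q_def)
  then obtain N where N: "\<And>k. k \<ge> N \<Longrightarrow> \<bar>\<delta> k\<bar> < q"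
    using LIMSEQ_D[OF assms(2)] by force
  have "l2norm M (\<lambda>x. U k x - U l x) < e" if "k \<ge> N" "l \<ge> N" for k l
  proof (rule power2_less_imp_less)
    have "\<delta> k + \<delta> l \<le> 2 * q"
      using N[OF that(1)] N[OF that(2)] by linarith
    then have "K * (\<delta> k + \<delta> l) \<le> K * (2 * q)"
      using assms(3) by (intro mult_left_mono) auto
    also have "\<dots> < e\<^sup>2"
      using assms(3) \<open>0 < e\<close> by (simp add: q_def field_simps)
    finally show "(l2norm M (\<lambda>x. U k x - U l x))\<^sup>2 < e\<^sup>2"
      using assms(1)[of k l] by simp
  qed (use \<open>0 < e\<close> in simp)
  then show "\<exists>N. \<forall>k\<ge>N. \<forall>l\<ge>N. l2norm M (\<lambda>x. U k x - U l x) < e"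
    by blast
qed

section \<open>Minimisation in closed subspaces\<close>

lemma ex_minimizing_sequence:
  fixes J :: "'a \<Rightarrow> real"
  assumes "W \<noteq> {}" "bdd_below (J ` W)"
  obtains V where "\<And>k. V k \<in> W" "\<And>k. J (V k) < Inf (J ` W) + inverse (real (Suc k))"
proof -
  have "\<exists>v. v \<in> W \<and> J v < Inf (J ` W) + inverse (real (Suc k))" for k
    using cInf_lessD[of "J ` W" "Inf (J ` W) + inverse (real (Suc k))"] assms(1) by auto
  then show ?thesis
    using that by metis
qed

lemma l2norm_square_snd_add_scaleR:
  assumes "U \<in> l2 M" "V \<in> l2 M"
  shows "(l2norm M (\<lambda>x. snd (U x + t *\<^sub>R V x)))\<^sup>2 = (l2norm M (\<lambda>x. snd (U x)))\<^sup>2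
    + 2 * t * (LINT x|M. snd (U x) \<bullet> snd (V x)) + t\<^sup>2 * (l2norm M (\<lambda>x. snd (V x)))\<^sup>2"
  using l2norm_square_add[OF l2_snd[OF assms(1)] l2_scaleR[OF l2_snd[OF assms(2)], of t]]
  by (simp add: l2norm_scaleR power_mult_distrib)

lemma l2norm_square_fst_add_scaleR:
  assumes "U \<in> l2 M" "V \<in> l2 M"
  shows "(l2norm M (\<lambda>x. fst (U x + t *\<^sub>R V x)))\<^sup>2 = (l2norm M (\<lambda>x. fst (U x)))\<^sup>2
    + 2 * t * (LINT x|M. fst (U x) \<bullet> fst (V x)) + t\<^sup>2 * (l2norm M (\<lambda>x. fst (V x)))\<^sup>2"
  using l2norm_square_add[OF l2_fst[OF assms(1)] l2_scaleR[OF l2_fst[OF assms(2)], of t]]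
  by (simp add: l2norm_scaleR power_mult_distrib)

text \<open>A Riesz representation for the inner product of second components, obtained by
  minimising \<open>J V = (e V)^2 - 2 * ell V\<close>. The Poincare inequality enters twice: it
  bounds the linear term, so that \<open>J\<close> has an infimum, and it makes the energy
  \<open>e\<close> control the full norm, so that a sequence that is Cauchy in energy is Cauchy in
  L2.\<close>

lemma l2_energy_representation:
  fixes D :: "('a \<Rightarrow> 'b::euclidean_space \<times> 'c::euclidean_space) set"
  assumes D: "l2_subspace M D"
    and poincare: "\<And>V. V \<in> l2_closure M D \<Longrightarrow>
      l2norm M (\<lambda>x. fst (V x)) \<le> C * l2norm M (\<lambda>x. snd (V x))"
    and h: "h \<in> l2 M"
  obtains U where "U \<in> l2_closure M D"
    "\<And>V. V \<in> l2_closure M D \<Longrightarrow> (LINT x|M. snd (U x) \<bullet> snd (V x)) = (LINT x|M. h x \<bullet> fst (V x))"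
proof -
  define W where "W = l2_closure M D"
  have W: "l2_subspace M W"
    unfolding W_def by (rule l2_subspace_closure[OF D])
  define e where "e V = l2norm M (\<lambda>x. snd (V x))" for V :: "'a \<Rightarrow> 'b \<times> 'c"
  define ell where "ell V = (LINT x|M. h x \<bullet> fst (V x))" for V :: "'a \<Rightarrow> 'b \<times> 'c"
  define J where "J V = (e V)\<^sup>2 - 2 * ell V" for V
  have Wl2: "V \<in> l2 M" if "V \<in> W" for V
    using l2_subspace_l2[OF W that] .
  have ell_add: "ell (\<lambda>x. U x + t *\<^sub>R V x) = ell U + t * ell V" if "U \<in> W" "V \<in> W" for U V t
    using l2_integrable_inner[OF h l2_fst[OF Wl2[OF that(1)]]]
      l2_integrable_inner[OF h l2_fst[OF Wl2[OF that(2)]]]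
    by (simp add: ell_def inner_add_right)
  have J_add: "J (\<lambda>x. U x + t *\<^sub>R V x)
      = J U + 2 * t * ((LINT x|M. snd (U x) \<bullet> snd (V x)) - ell V) + t\<^sup>2 * (e V)\<^sup>2"
    if "U \<in> W" "V \<in> W" for U V t
    using l2norm_square_snd_add_scaleR[OF Wl2[OF that(1)] Wl2[OF that(2)], of t] ell_add[OF that, of t]
    by (simp add: J_def e_def algebra_simps)
  \<comment> \<open>Once the linear term is estimated, this is the nonnegativity of the square of
    \<open>e V - l2norm M h * C\<close>.\<close>
  have J_lower: "- (l2norm M h * C)\<^sup>2 \<le> J V" if "V \<in> W" for V
  proof -
    have "ell V \<le> l2norm M h * l2norm M (\<lambda>x. fst (V x))"
      using l2_Cauchy_Schwarz[OF h l2_fst[OF Wl2[OF that]]] by (simp add: ell_def)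
    also have "\<dots> \<le> l2norm M h * (C * e V)"
      using poincare that by (intro mult_left_mono) (auto simp: l2norm_nonneg W_def e_def)
    finally have "ell V \<le> (l2norm M h * C) * e V"
      by (simp add: mult.assoc)
    then show ?thesis
      using zero_le_power2[of "e V - l2norm M h * C"]
      by (simp add: J_def power2_diff algebra_simps)
  qed
  define m where "m = Inf (J ` W)"
  have bdd: "bdd_below (J ` W)"
    using J_lower by (intro bdd_belowI2) 
  have m_le: "m \<le> J V" if "V \<in> W" for V
    unfolding m_def using cINF_lower[OF bdd that] .
  obtain V where V: "\<And>k. V k \<in> W" "\<And>k. J (V k) < m + inverse (real (Suc k))"
    using ex_minimizing_sequence[OF _ bdd] l2_subspace_0[OF W] unfolding m_def by blast
  have norm_le: "(l2norm M U)\<^sup>2 \<le> (C\<^sup>2 + 1) * (e U)\<^sup>2" if "U \<in> W" for U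
  proof -
    have "(l2norm M (\<lambda>x. fst (U x)))\<^sup>2 \<le> (C * e U)\<^sup>2"
      using poincare that by (intro power_mono) (auto simp: W_def e_def l2norm_nonneg)
    then show ?thesis
      by (simp add: l2norm_square_Pair[OF Wl2[OF that]] e_def power_mult_distrib algebra_simps)
  qed
  have "(l2norm M (\<lambda>x. V k x - V l x))\<^sup>2 \<le> (2 * (C\<^sup>2 + 1)) * (inverse (real (Suc k)) + inverse (real (Suc l)))"
    for k l
  proof -
    \<comment> \<open>The midpoint is written as a perturbation of \<open>V l\<close>, so that
      \<open>J_add\<close> gives \<open>J mid\<close> at \<open>t = 1/2\<close> and
      \<open>J (V k)\<close> at \<open>t = 1\<close>. Eliminating the linear term between the two
      leaves the squared energy of \<open>V k - V l\<close>, and \<open>J mid\<close> cannot lie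
      below \<open>m\<close>.\<close>
    define mid where "mid x = V l x + (1/2) *\<^sub>R (V k x - V l x)" for x
    have d: "(\<lambda>x. V k x - V l x) \<in> W"
      using l2_subspace_diff[OF W V(1) V(1)] .
    have "mid \<in> W"
      unfolding mid_def using l2_subspace_add[OF W V(1) l2_subspace_scaleR[OF W d]] .
    have "J (V k) = J (V l) + 2 * ((LINT x|M. snd (V l x) \<bullet> snd (V k x - V l x)) - ell (\<lambda>x. V k x - V l x))
        + (e (\<lambda>x. V k x - V l x))\<^sup>2"
      using J_add[OF V(1)[of l] d, of 1] by simp
    moreover have "J mid = J (V l) + ((LINT x|M. snd (V l x) \<bullet> snd (V k x - V l x)) - ell (\<lambda>x. V k x - V l x))
        + (e (\<lambda>x. V k x - V l x))\<^sup>2 / 4"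
      unfolding mid_def using J_add[OF V(1)[of l] d, of "1/2"] by (simp add: power2_eq_square)
    ultimately have "(e (\<lambda>x. V k x - V l x))\<^sup>2 = 2 * J (V k) + 2 * J (V l) - 4 * J mid"
      by (simp add: field_simps)
    also have "\<dots> \<le> 2 * (inverse (real (Suc k)) + inverse (real (Suc l)))"
    proof -
      have "2 * p + 2 * q - 4 * s \<le> 2 * (a + b)" if "p < m + a" "q < m + b" "m \<le> s" for p q s a b :: real
        using that by simp
      then show ?thesis
        using V(2) m_le[OF \<open>mid \<in> W\<close>] by blast
    qed
    finally have "(e (\<lambda>x. V k x - V l x))\<^sup>2 \<le> 2 * (inverse (real (Suc k)) + inverse (real (Suc l)))" .
    then have "(C\<^sup>2 + 1) * (e (\<lambda>x. V k x - V l x))\<^sup>2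
        \<le> (C\<^sup>2 + 1) * (2 * (inverse (real (Suc k)) + inverse (real (Suc l))))"
      by (rule mult_left_mono) simp
    then show ?thesis
      using norm_le[OF d] by (simp only: mult.assoc mult.left_commute)
  qed
  then have "l2_Cauchy M V"
    by (rule l2_CauchyI_square[OF _ LIMSEQ_inverse_real_of_nat]) simp
  from l2_closure_complete[OF D V(1)[unfolded W_def] this]
  obtain U where U: "U \<in> W" "l2_lim M V U"
    unfolding W_def .
  have "(\<lambda>k. e (V k)) \<longlonglongrightarrow> e U"
    unfolding e_def
    by (rule l2norm_tendsto[OF l2_snd[OF Wl2[OF V(1)]] l2_snd[OF Wl2[OF U(1)]]
          l2_lim_snd[OF Wl2[OF V(1)] Wl2[OF U(1)] U(2), unfolded l2_lim_def]])
  moreover have "(\<lambda>k. ell (V k)) \<longlonglongrightarrow> ell U"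
    unfolding ell_def inner_commute[of "h _"]
    by (rule l2_tendsto_inner[OF l2_fst[OF Wl2[OF V(1)]] l2_fst[OF Wl2[OF U(1)]]
          l2_lim_fst[OF Wl2[OF V(1)] Wl2[OF U(1)] U(2), unfolded l2_lim_def] h])
  ultimately have "(\<lambda>k. J (V k)) \<longlonglongrightarrow> J U"
    unfolding J_def by (intro tendsto_intros)
  moreover have "(\<lambda>k. m + inverse (real (Suc k))) \<longlonglongrightarrow> m"
    using tendsto_add[OF tendsto_const LIMSEQ_inverse_real_of_nat, of m] by simp
  ultimately have "J U \<le> m"
    using V(2) by (intro LIMSEQ_le) (auto intro: less_imp_le)
  have "(LINT x|M. snd (U x) \<bullet> snd (V x)) = ell V" if "V \<in> W" for V
  proof -
    \<comment> \<open>First variation at the minimiser: the change of \<open>J\<close> from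
      \<open>U\<close> in the direction \<open>V\<close> is a nonnegative quadratic in
      \<open>t\<close> without constant term.\<close>
    have "0 \<le> 0 + 2 * t * ((LINT x|M. snd (U x) \<bullet> snd (V x)) - ell V) + t\<^sup>2 * (e V)\<^sup>2" for t
      using J_add[OF U(1) that, of t] m_le[OF l2_subspace_add[OF W U(1) l2_subspace_scaleR[OF W that]], of t]
        \<open>J U \<le> m\<close> by linarith
    from nonneg_quadratic_discriminant[OF this] show ?thesis
      by simp
  qed
  then show ?thesis
    using that U(1) unfolding W_def ell_def by blast
qed

text \<open>The infimum is taken over normalised elements of \<open>D\<close>, where the compactness
  hypothesis applies, and the inequality passes to the closure by continuity. Compactness makes the
  first components of a minimising sequence Cauchy; the parallelogram law then does the same for the
  second components, so the minimiser is a limit in norm.\<close>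

lemma l2_rayleigh_minimizer:
  fixes D :: "('a \<Rightarrow> 'b::euclidean_space \<times> 'c::euclidean_space) set"
  assumes D: "l2_subspace M D"
    and compact: "\<And>(\<Phi> :: nat \<Rightarrow> 'a \<Rightarrow> 'b \<times> 'c) B. (\<And>k. \<Phi> k \<in> D) \<Longrightarrow> (\<And>k. l2norm M (\<Phi> k) \<le> B) \<Longrightarrow>
      \<exists>r :: nat \<Rightarrow> nat. strict_mono r \<and> l2_Cauchy M (\<lambda>k x. fst (\<Phi> (r k) x))"
    and nontrivial: "V0 \<in> D" "l2norm M (\<lambda>x. fst (V0 x)) \<noteq> 0"
  obtains \<mu> U where "U \<in> l2_closure M D" "l2norm M (\<lambda>x. fst (U x)) \<noteq> 0"
    "\<And>V. V \<in> l2_closure M D \<Longrightarrow>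
      \<mu> * (l2norm M (\<lambda>x. fst (V x)))\<^sup>2 \<le> (l2norm M (\<lambda>x. snd (V x)))\<^sup>2"
    "\<And>V. V \<in> l2_closure M D \<Longrightarrow>
      (LINT x|M. snd (U x) \<bullet> snd (V x)) = \<mu> * (LINT x|M. fst (U x) \<bullet> fst (V x))"
proof -
  define n where "n V = l2norm M (\<lambda>x. fst (V x))" for V :: "'a \<Rightarrow> 'b \<times> 'c"
  define e where "e V = l2norm M (\<lambda>x. snd (V x))" for V :: "'a \<Rightarrow> 'b \<times> 'c"
  define S where "S = {V \<in> D. n V = 1}"
  define \<mu> where "\<mu> = Inf ((\<lambda>V. (e V)\<^sup>2) ` S)"
  define W where "W = l2_closure M D"
  have W: "l2_subspace M W"
    unfolding W_def by (rule l2_subspace_closure[OF D])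
  have Dl2: "V \<in> l2 M" if "V \<in> D" for V
    using l2_subspace_l2[OF D that] .
  have Wl2: "V \<in> l2 M" if "V \<in> W" for V
    using l2_subspace_l2[OF W that] .
  have n_scale: "n (\<lambda>x. c *\<^sub>R V x) = \<bar>c\<bar> * n V" and e_scale: "e (\<lambda>x. c *\<^sub>R V x) = \<bar>c\<bar> * e V" for c V
    by (simp_all add: n_def e_def l2norm_scaleR)
  have normalized: "(\<lambda>x. (1 / n V) *\<^sub>R V x) \<in> S" if "V \<in> D" "n V \<noteq> 0" for V
    using l2_subspace_scaleR[OF D that(1)] that(2)
    by (simp add: S_def n_scale) (simp add: n_def l2norm_nonneg)
  have "S \<noteq> {}"
    using normalized[OF nontrivial(1)] nontrivial(2) by (auto simp: n_def)
  have bdd: "bdd_below ((\<lambda>V. (e V)\<^sup>2) ` S)"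
    by (intro bdd_belowI2[of _ 0]) simp
  have "0 \<le> \<mu>"
    unfolding \<mu>_def using \<open>S \<noteq> {}\<close> by (intro cINF_greatest) auto
  have rayleigh_D: "\<mu> * (n V)\<^sup>2 \<le> (e V)\<^sup>2" if "V \<in> D" for V
  proof (cases "n V = 0")
    case False
    have "\<mu> \<le> (e (\<lambda>x. (1 / n V) *\<^sub>R V x))\<^sup>2"
      unfolding \<mu>_def using cINF_lower[OF bdd normalized[OF that False]] .
    then show ?thesis
      using False by (simp add: e_scale power_mult_distrib power_divide field_simps)
  qed simp
  have lim_ne: "(\<lambda>k. n (\<Phi> k)) \<longlonglongrightarrow> n V" "(\<lambda>k. e (\<Phi> k)) \<longlonglongrightarrow> e V"
    if "\<And>k. \<Phi> k \<in> D" "V \<in> W" "l2_lim M \<Phi> V" for \<Phi> V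
    unfolding n_def e_def
    by (rule l2norm_tendsto[OF l2_fst[OF Dl2[OF that(1)]] l2_fst[OF Wl2[OF that(2)]]
          l2_lim_fst[OF Dl2[OF that(1)] Wl2[OF that(2)] that(3), unfolded l2_lim_def]],
        rule l2norm_tendsto[OF l2_snd[OF Dl2[OF that(1)]] l2_snd[OF Wl2[OF that(2)]]
          l2_lim_snd[OF Dl2[OF that(1)] Wl2[OF that(2)] that(3), unfolded l2_lim_def]])
  have rayleigh: "\<mu> * (n V)\<^sup>2 \<le> (e V)\<^sup>2" if V: "V \<in> W" for V
  proof -
    obtain \<Phi> where \<Phi>: "\<And>k. \<Phi> k \<in> D" "l2_lim M \<Phi> V"
      using l2_closureE[OF V[unfolded W_def]] by metis
    have "(\<lambda>k. \<mu> * (n (\<Phi> k))\<^sup>2) \<longlonglongrightarrow> \<mu> * (n V)\<^sup>2"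
      by (intro tendsto_intros lim_ne \<Phi> that)
    moreover have "(\<lambda>k. (e (\<Phi> k))\<^sup>2) \<longlonglongrightarrow> (e V)\<^sup>2"
      by (intro tendsto_intros lim_ne \<Phi> that)
    ultimately show ?thesis
      by (rule LIMSEQ_le) (use rayleigh_D[OF \<Phi>(1)] in blast)
  qed
  obtain \<Psi> where \<Psi>: "\<And>k. \<Psi> k \<in> S" "\<And>k. (e (\<Psi> k))\<^sup>2 < \<mu> + inverse (real (Suc k))"
    using ex_minimizing_sequence[OF \<open>S \<noteq> {}\<close> bdd] unfolding \<mu>_def by blast
  have \<Psi>D: "\<Psi> k \<in> D" and \<Psi>n: "n (\<Psi> k) = 1" for k
    using \<Psi>(1) by (auto simp: S_def)
  have "l2norm M (\<Psi> k) \<le> sqrt (2 + \<mu>)" for k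
  proof (rule real_le_rsqrt)
    have "inverse (real (Suc k)) \<le> 1"
      by (simp add: inverse_eq_divide)
    then show "(l2norm M (\<Psi> k))\<^sup>2 \<le> 2 + \<mu>"
      using \<Psi>(2)[of k] \<Psi>n[of k] l2norm_square_Pair[OF Dl2[OF \<Psi>D[of k]]] by (simp add: n_def e_def)
  qed
  from compact[of \<Psi>, OF \<Psi>D this] obtain r where r: "strict_mono r" "l2_Cauchy M (\<lambda>k x. fst (\<Psi> (r k) x))"
    by blast
  define \<Phi> where "\<Phi> k = \<Psi> (r k)" for k
  have \<Phi>D: "\<Phi> k \<in> D" and \<Phi>n: "n (\<Phi> k) = 1" for k
    using \<Psi>D \<Psi>n by (auto simp: \<Phi>_def)
  have \<Phi>e: "(e (\<Phi> k))\<^sup>2 < \<mu> + inverse (real (Suc k))" for k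
  proof -
    have "inverse (real (Suc (r k))) \<le> inverse (real (Suc k))"
      using seq_suble[OF r(1), of k] by (intro le_imp_inverse_le) auto
    then show ?thesis
      using \<Psi>(2)[of "r k"] unfolding \<Phi>_def by linarith
  qed
  \<comment> \<open>The parallelogram law in both components. The Rayleigh bound for the sum
    \<open>\<Phi> k + \<Phi> l\<close> estimates its energy from below by \<open>\<mu>\<close> times
    4 minus the squared norm of the difference, and \<open>4 * \<mu>\<close> cancels against the
    almost minimal energies.\<close>
  have diff: "(e (\<lambda>x. \<Phi> k x - \<Phi> l x))\<^sup>2
      \<le> 2 * inverse (real (Suc k)) + 2 * inverse (real (Suc l)) + \<mu> * (n (\<lambda>x. \<Phi> k x - \<Phi> l x))\<^sup>2" for k l
  proof -
    have 1: "(e (\<lambda>x. \<Phi> k x - \<Phi> l x))\<^sup>2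
        = 2 * (e (\<Phi> k))\<^sup>2 + 2 * (e (\<Phi> l))\<^sup>2 - (e (\<lambda>x. \<Phi> k x + \<Phi> l x))\<^sup>2"
      using l2norm_parallelogram[OF l2_snd[OF Dl2[OF \<Phi>D]] l2_snd[OF Dl2[OF \<Phi>D]], of k l]
      by (simp add: e_def)
    have 2: "(n (\<lambda>x. \<Phi> k x - \<Phi> l x))\<^sup>2 = 4 - (n (\<lambda>x. \<Phi> k x + \<Phi> l x))\<^sup>2"
      using l2norm_parallelogram[OF l2_fst[OF Dl2[OF \<Phi>D]] l2_fst[OF Dl2[OF \<Phi>D]], of k l] \<Phi>n[of k] \<Phi>n[of l]
      by (simp add: n_def)
    have "\<mu> * (n (\<lambda>x. \<Phi> k x + \<Phi> l x))\<^sup>2 \<le> (e (\<lambda>x. \<Phi> k x + \<Phi> l x))\<^sup>2"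
      by (rule rayleigh_D[OF l2_subspace_add[OF D \<Phi>D \<Phi>D]])
    then show ?thesis
      using \<Phi>e[of k] \<Phi>e[of l] unfolding 1 2 by (simp add: algebra_simps)
  qed
  have "l2_Cauchy M \<Phi>"
    unfolding l2_Cauchy_def
  proof (intro allI impI)
    fix \<epsilon> :: real
    assume "0 < \<epsilon>"
    \<comment> \<open>The final estimate is \<open>4 * \<eta> + (1 + \<mu>) * \<eta>\<close>, which
      is at most five eighths of \<open>\<epsilon>^2\<close>.\<close>
    define \<eta> where "\<eta> = \<epsilon>\<^sup>2 / (8 * (1 + \<mu>))"
    have \<eta>: "0 < \<eta>" "\<eta> \<le> \<epsilon>\<^sup>2 / 8" "(1 + \<mu>) * \<eta> = \<epsilon>\<^sup>2 / 8"
      using \<open>0 < \<epsilon>\<close> \<open>0 \<le> \<mu>\<close> by (auto simp: \<eta>_def field_simps)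
    obtain N1 where N1: "\<And>k l. k \<ge> N1 \<Longrightarrow> l \<ge> N1 \<Longrightarrow>
        l2norm M (\<lambda>x. fst (\<Phi> k x) - fst (\<Phi> l x)) < sqrt \<eta>"
      using r(2) \<eta>(1) unfolding l2_Cauchy_def \<Phi>_def by (meson real_sqrt_gt_zero)
    obtain N2 where N2: "inverse (real (Suc N2)) < \<eta>"
      using reals_Archimedean[OF \<eta>(1)] by blast
    have "l2norm M (\<lambda>x. \<Phi> k x - \<Phi> l x) < \<epsilon>" if "k \<ge> max N1 N2" "l \<ge> max N1 N2" for k l
    proof (rule power2_less_imp_less)
      have inv: "inverse (real (Suc j)) < \<eta>" if "j \<ge> max N1 N2" for j
      proof -
        have "inverse (real (Suc j)) \<le> inverse (real (Suc N2))"
          using that by (intro le_imp_inverse_le) auto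
        with N2 show ?thesis
          by linarith
      qed
      have nd: "(n (\<lambda>x. \<Phi> k x - \<Phi> l x))\<^sup>2 < \<eta>"
      proof -
        have "(n (\<lambda>x. \<Phi> k x - \<Phi> l x))\<^sup>2 < (sqrt \<eta>)\<^sup>2"
          using N1[of k l] that by (intro power_strict_mono) (auto simp: n_def l2norm_nonneg)
        then show ?thesis
          using \<eta>(1) by simp
      qed
      have "(l2norm M (\<lambda>x. \<Phi> k x - \<Phi> l x))\<^sup>2 = (n (\<lambda>x. \<Phi> k x - \<Phi> l x))\<^sup>2 + (e (\<lambda>x. \<Phi> k x - \<Phi> l x))\<^sup>2"
        using l2norm_square_Pair[OF l2_diff[OF Dl2[OF \<Phi>D] Dl2[OF \<Phi>D]], of k l] by (simp add: n_def e_def)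
      also have "\<dots> \<le> 2 * inverse (real (Suc k)) + 2 * inverse (real (Suc l))
          + (1 + \<mu>) * (n (\<lambda>x. \<Phi> k x - \<Phi> l x))\<^sup>2"
        using diff[of k l] by (simp add: algebra_simps)
      also have "\<dots> \<le> 2 * \<eta> + 2 * \<eta> + (1 + \<mu>) * \<eta>"
        using inv[OF that(1)] inv[OF that(2)] nd \<open>0 \<le> \<mu>\<close>
        by (intro add_mono mult_left_mono) auto
      also have "\<dots> < \<epsilon>\<^sup>2"
        using \<eta> \<open>0 < \<epsilon>\<close> zero_less_power[of \<epsilon> 2] by linarith
      finally show "(l2norm M (\<lambda>x. \<Phi> k x - \<Phi> l x))\<^sup>2 < \<epsilon>\<^sup>2" .
    qed (use \<open>0 < \<epsilon>\<close> in simp)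
    then show "\<exists>N. \<forall>k\<ge>N. \<forall>l\<ge>N. l2norm M (\<lambda>x. \<Phi> k x - \<Phi> l x) < \<epsilon>"
      by blast
  qed
  from l2_closure_complete[OF D subsetD[OF l2_closure_superset[OF D] \<Phi>D] this]
  obtain U where U: "U \<in> W" "l2_lim M \<Phi> U"
    unfolding W_def .
  have nU: "n U = 1"
    using LIMSEQ_unique[OF lim_ne(1)[OF \<Phi>D U]] tendsto_const[of 1] unfolding \<Phi>n by blast
  have "(e U)\<^sup>2 \<le> \<mu>"
  proof (rule LIMSEQ_le)
    show "(\<lambda>k. (e (\<Phi> k))\<^sup>2) \<longlonglongrightarrow> (e U)\<^sup>2"
      by (intro tendsto_intros lim_ne \<Phi>D U)
    show "(\<lambda>k. \<mu> + inverse (real (Suc k))) \<longlonglongrightarrow> \<mu>"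
      using tendsto_add[OF tendsto_const LIMSEQ_inverse_real_of_nat, of \<mu>] by simp
    show "\<exists>N. \<forall>k\<ge>N. (e (\<Phi> k))\<^sup>2 \<le> \<mu> + inverse (real (Suc k))"
      using \<Phi>e by (meson less_imp_le)
  qed
  have "(LINT x|M. snd (U x) \<bullet> snd (V x)) = \<mu> * (LINT x|M. fst (U x) \<bullet> fst (V x))" if "V \<in> W" for V
  proof -
    let ?b = "(LINT x|M. snd (U x) \<bullet> snd (V x)) - \<mu> * (LINT x|M. fst (U x) \<bullet> fst (V x))"
    \<comment> \<open>The quadratic form \<open>e^2 - \<mu> * n^2\<close> is nonnegative on
      \<open>W\<close> and vanishes at \<open>U\<close>, so its first variation there vanishes; this
      is the eigenvalue equation.\<close>
    have "0 \<le> 0 + 2 * t * ?b + t\<^sup>2 * ((e V)\<^sup>2 - \<mu> * (n V)\<^sup>2)" for t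
    proof -
      have "\<mu> * (n (\<lambda>x. U x + t *\<^sub>R V x))\<^sup>2 \<le> (e (\<lambda>x. U x + t *\<^sub>R V x))\<^sup>2"
        by (rule rayleigh[OF l2_subspace_add[OF W U(1) l2_subspace_scaleR[OF W that]]])
      then show ?thesis
        using l2norm_square_snd_add_scaleR[OF Wl2[OF U(1)] Wl2[OF that], of t]
          l2norm_square_fst_add_scaleR[OF Wl2[OF U(1)] Wl2[OF that], of t] nU \<open>(e U)\<^sup>2 \<le> \<mu>\<close>
        by (simp add: n_def e_def algebra_simps)
    qed
    from nonneg_quadratic_discriminant[OF this] show ?thesis
      by simp
  qed
  then show ?thesis
    using that[of U \<mu>] U(1) nU rayleigh unfolding W_def n_def e_def by simp
qed

section \<open>Translation estimate and ball averages\<close>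

lemma C_k_1_continuous: "C_k (Suc 0) \<phi> \<Longrightarrow> continuous_on UNIV \<phi>"
  by (auto simp: continuous_on_eq_continuous_within intro: differentiable_imp_continuous_within)

lemma C_k_1_continuous_gradient:
  fixes \<phi> :: "real ^ 'n \<Rightarrow> 'b::real_normed_vector"
  shows "C_k (Suc 0) \<phi> \<Longrightarrow> continuous_on UNIV (gradient \<phi>)"
  unfolding gradient_def[abs_def] by (auto intro!: continuous_on_vec_lambda)

lemma C_k_1_has_derivative:
  fixes \<phi> :: "real ^ 'n \<Rightarrow> 'b::real_normed_vector"
  assumes "C_k (Suc 0) \<phi>"
  shows "(\<phi> has_derivative (\<lambda>h. \<Sum>i\<in>UNIV. (h $ i) *\<^sub>R gradient \<phi> x $ i)) (at x)"
proof -
  have d: "(\<phi> has_derivative frechet_derivative \<phi> (at x)) (at x)"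
    using assms frechet_derivative_works by auto
  then interpret linear "frechet_derivative \<phi> (at x)"
    by (rule has_derivative_linear)
  have "frechet_derivative \<phi> (at x) h = (\<Sum>i\<in>UNIV. (h $ i) *\<^sub>R gradient \<phi> x $ i)" for h
  proof -
    have "h = (\<Sum>i\<in>UNIV. (h $ i) *\<^sub>R axis i 1)"
      using basis_expansion[of h] by (simp add: scalar_mult_eq_scaleR)
    then have "frechet_derivative \<phi> (at x) h
        = frechet_derivative \<phi> (at x) (\<Sum>i\<in>UNIV. (h $ i) *\<^sub>R axis i 1)"
      by (rule arg_cong)
    then show ?thesis
      by (simp add: sum scaleR gradient_def partial_deriv_def)
  qed
  then have "frechet_derivative \<phi> (at x) = (\<lambda>h. \<Sum>i\<in>UNIV. (h $ i) *\<^sub>R gradient \<phi> x $ i)"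
    by (rule ext)
  with d show ?thesis
    by (simp only:)
qed

lemma norm_sum_scaleR_le:
  fixes h :: "real ^ 'n" and g :: "'b::real_normed_vector ^ 'n"
  shows "norm (\<Sum>i\<in>UNIV. (h $ i) *\<^sub>R g $ i) \<le> norm h * norm g"
proof -
  have "norm (\<Sum>i\<in>UNIV. (h $ i) *\<^sub>R g $ i) \<le> (\<Sum>i\<in>UNIV. \<bar>norm (h $ i)\<bar> * \<bar>norm (g $ i)\<bar>)"
    by (rule order_trans[OF norm_sum]) simp
  also have "\<dots> \<le> L2_set (\<lambda>i. norm (h $ i)) UNIV * L2_set (\<lambda>i. norm (g $ i)) UNIV"
    by (rule L2_set_mult_ineq)
  finally show ?thesis
    by (simp add: norm_vec_def)
qed

text \<open>The complement of \<open>K\<close> is open, so the function vanishes on a whole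
  neighbourhood of \<open>x\<close>, and the derivative there is that of the zero function.\<close>

lemma gradient_eq_0_outside:
  fixes \<phi> :: "real ^ 'n \<Rightarrow> 'b::real_normed_vector"
  assumes "closed K" "\<And>x. x \<notin> K \<Longrightarrow> \<phi> x = 0" "x \<notin> K"
  shows "gradient \<phi> x = 0"
proof -
  have "((\<lambda>_. 0 :: 'b) has_derivative (\<lambda>_. 0)) (at x)"
    by simp
  then have "(\<phi> has_derivative (\<lambda>_. 0)) (at x)"
    by (rule has_derivative_transform_within_open[of _ _ _ _ "- K"]) (use assms in auto)
  then have "frechet_derivative \<phi> (at x) = (\<lambda>_. 0)"
    by (metis frechet_derivative_at)
  then show ?thesis
    by (simp add: gradient_def partial_deriv_def vec_eq_iff)
qed

lemma l2norm_square_nn_integral: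
  "u \<in> l2 M \<Longrightarrow> ennreal ((l2norm M u)\<^sup>2) = (\<integral>\<^sup>+x. ennreal ((norm (u x))\<^sup>2) \<partial>M)"
  unfolding l2norm_square by (subst nn_integral_eq_integral) (auto dest: l2_integrable)

text \<open>Cauchy-Schwarz over \<open>S\<close>. The form in \<open>ennreal\<close> can be chained
  with Tonelli's theorem over the whole space, where the integrals may be infinite.\<close>

lemma set_integral_norm_square_le:
  fixes f :: "'a::euclidean_space \<Rightarrow> 'b::euclidean_space"
  assumes "compact S" "continuous_on UNIV f"
  shows "ennreal ((norm (LINT x:S|lborel. f x))\<^sup>2)
    \<le> ennreal (measure lborel S) * (\<integral>\<^sup>+x\<in>S. ennreal ((norm (f x))\<^sup>2) \<partial>lborel)"
proof -
  let ?M = "restrict_space lborel S"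
  have S: "S \<in> sets lborel"
    using assms(1) by (simp add: borel_compact)
  have "emeasure lborel S < \<infinity>"
    using assms(1) by (intro emeasure_bounded_finite compact_imp_bounded)
  then have fin: "finite_measure ?M"
    using S by (intro finite_measureI) (simp add: emeasure_restrict_space space_restrict_space)
  have "continuous_on S (\<lambda>x. (norm (f x))\<^sup>2)"
    by (intro continuous_intros continuous_on_subset[OF assms(2)]) simp
  from borel_integrable_compact[OF assms(1) this]
  have "integrable ?M (\<lambda>x. (norm (f x))\<^sup>2)"
    using S by (subst integrable_restrict_space) auto
  moreover have "f \<in> borel_measurable ?M"
    using borel_measurable_continuous_onI[OF assms(2)] by (intro measurable_restrict_space1) simp
  ultimately have f: "f \<in> l2 ?M"
    by (simp add: l2_def)
  have "(norm (LINT x|?M. f x))\<^sup>2 \<le> measure ?M (space ?M) * (l2norm ?M f)\<^sup>2"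
    using l2_norm_integral_le[OF fin f] by (simp add: l2norm_square)
  moreover have "measure ?M (space ?M) = measure lborel S"
    using S by (simp add: measure_restrict_space space_restrict_space)
  moreover have "(LINT x|?M. f x) = (LINT x:S|lborel. f x)"
    using S by (simp add: integral_restrict_space set_lebesgue_integral_def)
  ultimately have "ennreal ((norm (LINT x:S|lborel. f x))\<^sup>2)
      \<le> ennreal (measure lborel S) * ennreal ((l2norm ?M f)\<^sup>2)"
    by (simp flip: ennreal_mult add: ennreal_leI)
  also have "ennreal ((l2norm ?M f)\<^sup>2) = (\<integral>\<^sup>+x\<in>S. ennreal ((norm (f x))\<^sup>2) \<partial>lborel)"
    using S by (simp add: l2norm_square_nn_integral[OF f] nn_integral_restrict_space)
  finally show ?thesis .
qed

lemma nn_integral_lborel_translation: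
  fixes g :: "'a::euclidean_space \<Rightarrow> ennreal"
  assumes "g \<in> borel_measurable borel"
  shows "(\<integral>\<^sup>+x. g (x + c) \<partial>lborel) = (\<integral>\<^sup>+x. g x \<partial>lborel)"
proof -
  have "(\<integral>\<^sup>+x. g x \<partial>distr lborel borel ((+) c)) = (\<integral>\<^sup>+x. g (c + x) \<partial>lborel)"
    using assms by (intro nn_integral_distr) auto
  then show ?thesis
    by (simp add: lborel_distr_plus add.commute)
qed

text \<open>The fundamental theorem of calculus along the segment from \<open>x\<close> to
  \<open>x + z\<close>, followed by Cauchy-Schwarz over \<open>{0..1}\<close>, which has measure
  1.\<close>

lemma norm_difference_square_le:
  fixes \<phi> :: "real ^ 'n \<Rightarrow> 'b::euclidean_space"
  assumes "C_k (Suc 0) \<phi>"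
  shows "ennreal ((norm (\<phi> (x + z) - \<phi> x))\<^sup>2)
    \<le> (\<integral>\<^sup>+t\<in>{0..1}. ennreal ((norm z)\<^sup>2 * (norm (gradient \<phi> (x + t *\<^sub>R z)))\<^sup>2) \<partial>lborel)"
proof -
  define w where "w t = (\<Sum>i\<in>UNIV. (z $ i) *\<^sub>R gradient \<phi> (x + t *\<^sub>R z) $ i)" for t
  have cont: "continuous_on UNIV w"
    unfolding w_def
    by (intro continuous_intros continuous_on_compose2[OF C_k_1_continuous_gradient[OF assms]]) auto
  have deriv: "((\<lambda>t. \<phi> (x + t *\<^sub>R z)) has_vector_derivative w t) (at t within {0..1})" for t
  proof -
    have "((\<lambda>t. x + t *\<^sub>R z) has_derivative (\<lambda>s. s *\<^sub>R z)) (at t)"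
      by (auto intro!: derivative_eq_intros)
    from has_derivative_compose[OF this C_k_1_has_derivative[OF assms]]
    have "((\<lambda>t. \<phi> (x + t *\<^sub>R z)) has_derivative (\<lambda>s. s *\<^sub>R w t)) (at t)"
      by (simp add: w_def scaleR_sum_right)
    then show ?thesis
      unfolding has_vector_derivative_def by (rule has_derivative_at_withinI)
  qed
  have "(LINT t:{0..1}|lborel. w t) = \<phi> (x + z) - \<phi> x"
    using integral_FTC_atLeastAtMost[OF zero_le_one deriv continuous_on_subset[OF cont]]
    by (simp add: set_lebesgue_integral_def)
  then have "ennreal ((norm (\<phi> (x + z) - \<phi> x))\<^sup>2) \<le> (\<integral>\<^sup>+t\<in>{0..1}. ennreal ((norm (w t))\<^sup>2) \<partial>lborel)"
    using set_integral_norm_square_le[OF compact_Icc cont, of 0 1] by simp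
  also have "\<dots> \<le> (\<integral>\<^sup>+t\<in>{0..1}. ennreal ((norm z)\<^sup>2 * (norm (gradient \<phi> (x + t *\<^sub>R z)))\<^sup>2) \<partial>lborel)"
  proof (intro nn_integral_mono mult_right_mono ennreal_leI)
    show "(norm (w t))\<^sup>2 \<le> (norm z)\<^sup>2 * (norm (gradient \<phi> (x + t *\<^sub>R z)))\<^sup>2" for t
      using power_mono[OF norm_sum_scaleR_le norm_ge_zero, of z "gradient \<phi> (x + t *\<^sub>R z)" 2]
      by (simp add: w_def power_mult_distrib)
  qed simp
  finally show ?thesis .
qed

text \<open>After the integrals are exchanged, each inner one is a translate of the integral of the
  squared gradient, so the dependence on \<open>t\<close> disappears.\<close>

lemma nn_integral_difference_square_le:
  fixes \<phi> :: "real ^ 'n \<Rightarrow> 'b::euclidean_space"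
  assumes "C_k (Suc 0) \<phi>"
  shows "(\<integral>\<^sup>+x. ennreal ((norm (\<phi> (x + z) - \<phi> x))\<^sup>2) \<partial>lborel)
    \<le> ennreal ((norm z)\<^sup>2) * (\<integral>\<^sup>+x. ennreal ((norm (gradient \<phi> x))\<^sup>2) \<partial>lborel)"
proof -
  let ?g = "\<lambda>x. ennreal ((norm (gradient \<phi> x))\<^sup>2)"
  have [measurable]: "gradient \<phi> \<in> borel_measurable borel"
    by (intro borel_measurable_continuous_onI C_k_1_continuous_gradient assms)
  have "(\<integral>\<^sup>+x. ennreal ((norm (\<phi> (x + z) - \<phi> x))\<^sup>2) \<partial>lborel)
      \<le> (\<integral>\<^sup>+x. (\<integral>\<^sup>+t. ennreal ((norm z)\<^sup>2) * ?g (x + t *\<^sub>R z) * indicator {0..1} t \<partial>lborel) \<partial>lborel)"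
    using norm_difference_square_le[OF assms, of _ z] by (intro nn_integral_mono) (simp add: ennreal_mult)
  also have "\<dots> = (\<integral>\<^sup>+t. (\<integral>\<^sup>+x. ennreal ((norm z)\<^sup>2) * ?g (x + t *\<^sub>R z) * indicator {0..1} t \<partial>lborel) \<partial>lborel)"
    by (intro lborel_pair.Fubini'[symmetric]) measurable
  also have "\<dots> = (\<integral>\<^sup>+t. ennreal ((norm z)\<^sup>2) * (\<integral>\<^sup>+x. ?g (x + t *\<^sub>R z) \<partial>lborel) * indicator {0..1} t \<partial>lborel)"
    by (simp add: nn_integral_multc nn_integral_cmult)
  also have "\<dots> = (\<integral>\<^sup>+t. ennreal ((norm z)\<^sup>2) * (\<integral>\<^sup>+x. ?g x \<partial>lborel) * indicator {0..1::real} t \<partial>lborel)"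
    by (subst nn_integral_lborel_translation) auto
  also have "\<dots> = ennreal ((norm z)\<^sup>2) * (\<integral>\<^sup>+x. ?g x \<partial>lborel)"
    by (subst nn_integral_cmult_indicator) auto
  finally show ?thesis .
qed

text \<open>Convolution with the normalised indicator of a ball. The Lipschitz bound for the average
  will come from the translation estimate for \<open>\<phi>\<close> and not from derivatives of the
  kernel, so a discontinuous kernel does.\<close>

definition ball_average :: "real \<Rightarrow> (real ^ 'n \<Rightarrow> 'b::euclidean_space) \<Rightarrow> real ^ 'n \<Rightarrow> 'b" where
  "ball_average h \<phi> x = (1 / measure lborel (cball (0 :: real ^ 'n) h)) *\<^sub>R
     (LINT z:cball 0 h|lborel. \<phi> (x + z))"

text \<open>Jensen's inequality for the mean over the ball, multiplied through by its volume so that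
  no extended real has to be divided.\<close>

lemma norm_ball_average_square_le:
  fixes f :: "real ^ 'n \<Rightarrow> 'b::euclidean_space"
  assumes "0 < h" "continuous_on UNIV f"
  defines "c \<equiv> measure lborel (cball (0 :: real ^ 'n) h)"
  shows "ennreal c * ennreal ((norm ((1 / c) *\<^sub>R (LINT z:cball 0 h|lborel. f z)))\<^sup>2)
    \<le> (\<integral>\<^sup>+z\<in>cball 0 h. ennreal ((norm (f z))\<^sup>2) \<partial>lborel)"
proof -
  have c: "0 < c"
    unfolding c_def using assms(1) by (rule content_cball_pos)
  let ?I = "LINT z:cball 0 h|lborel. f z"
  have "ennreal c * ennreal ((norm ((1 / c) *\<^sub>R ?I))\<^sup>2) = ennreal (1 / c) * ennreal ((norm ?I)\<^sup>2)"
    using c by (simp flip: ennreal_mult add: power_mult_distrib power_divide) (simp add: power2_eq_square field_simps)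
  also have "\<dots> \<le> ennreal (1 / c) * (ennreal c * (\<integral>\<^sup>+z\<in>cball 0 h. ennreal ((norm (f z))\<^sup>2) \<partial>lborel))"
    unfolding c_def by (intro mult_left_mono set_integral_norm_square_le assms(2)) auto
  also have "\<dots> = (\<integral>\<^sup>+z\<in>cball 0 h. ennreal ((norm (f z))\<^sup>2) \<partial>lborel)"
    using c by (simp flip: mult.assoc ennreal_mult)
  finally show ?thesis .
qed

lemma set_integral_cball_diff:
  fixes f g :: "real ^ 'n \<Rightarrow> 'b::euclidean_space"
  assumes "continuous_on UNIV f" "continuous_on UNIV g"
  shows "(LINT z:cball (0::real^'n) h|lborel. f z - g z)
    = (LINT z:cball 0 h|lborel. f z) - (LINT z:cball 0 h|lborel. g z)"
  unfolding set_lebesgue_integral_def scaleR_diff_right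
  by (intro Bochner_Integration.integral_diff borel_integrable_compact compact_cball
      continuous_on_subset[OF assms(1)] continuous_on_subset[OF assms(2)]) auto

lemma continuous_on_translate:
  fixes \<phi> :: "'a::real_normed_vector \<Rightarrow> 'b::topological_space"
  assumes "continuous_on UNIV \<phi>"
  shows "continuous_on UNIV (\<lambda>z. \<phi> (x + z))"
  by (rule continuous_on_compose2[OF assms]) (auto intro!: continuous_intros)

text \<open>The deviation from \<open>\<phi> x\<close> is the mean of
  \<open>\<phi> (x + z) - \<phi> x\<close> over the ball. Jensen and Tonelli reduce the claim to
  translations by \<open>z\<close> with \<open>norm z \<le> h\<close>.\<close>

lemma ball_average_close:
  fixes \<phi> :: "real ^ 'n \<Rightarrow> 'b::euclidean_space"
  assumes "0 < h" "C_k (Suc 0) \<phi>"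
  shows "(\<integral>\<^sup>+x. ennreal ((norm (ball_average h \<phi> x - \<phi> x))\<^sup>2) \<partial>lborel)
    \<le> ennreal (h\<^sup>2) * (\<integral>\<^sup>+x. ennreal ((norm (gradient \<phi> x))\<^sup>2) \<partial>lborel)" (is "?L \<le> _ * ?I")
proof -
  define B where "B = cball (0 :: real ^ 'n) h"
  define c where "c = measure lborel B"
  have c: "0 < c"
    unfolding c_def B_def using assms(1) by (rule content_cball_pos)
  have cont: "continuous_on UNIV \<phi>"
    by (rule C_k_1_continuous[OF assms(2)])
  then have [measurable]: "\<phi> \<in> borel_measurable borel"
    by (rule borel_measurable_continuous_onI)
  have [measurable]: "B \<in> sets borel"
    by (simp add: B_def)
  have B_finite: "emeasure lborel B < \<infinity>"
    unfolding B_def by (rule emeasure_lborel_cball_finite)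
  then have eB: "emeasure lborel B = ennreal c"
    unfolding c_def by (intro emeasure_eq_ennreal_measure) (simp add: less_top)
  have "ball_average h \<phi> = (\<lambda>x. (1 / c) *\<^sub>R (LINT z|lborel. indicator B z *\<^sub>R \<phi> (x + z)))"
    by (simp add: fun_eq_iff ball_average_def set_lebesgue_integral_def c_def B_def)
  then have meas [measurable]: "ball_average h \<phi> \<in> borel_measurable borel"
    by simp
  have le: "ennreal c * ennreal ((norm (ball_average h \<phi> x - \<phi> x))\<^sup>2)
      \<le> (\<integral>\<^sup>+z\<in>B. ennreal ((norm (\<phi> (x + z) - \<phi> x))\<^sup>2) \<partial>lborel)" for x
  proof -
    have "(LINT z:B|lborel. \<phi> x) = c *\<^sub>R \<phi> x"
      unfolding set_lebesgue_integral_def using B_finite by (subst integral_scaleR_left) (auto simp: c_def)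
    then have "ball_average h \<phi> x - \<phi> x = (1 / c) *\<^sub>R (LINT z:cball 0 h|lborel. \<phi> (x + z) - \<phi> x)"
      using c by (simp add: set_integral_cball_diff continuous_on_translate cont ball_average_def
          scaleR_diff_right c_def B_def)
    then show ?thesis
      using norm_ball_average_square_le[OF assms(1), of "\<lambda>z. \<phi> (x + z) - \<phi> x"]
        continuous_on_translate[OF cont]
      by (simp add: c_def B_def continuous_intros)
  qed
  have "ennreal c * ?L = (\<integral>\<^sup>+x. ennreal c * ennreal ((norm (ball_average h \<phi> x - \<phi> x))\<^sup>2) \<partial>lborel)"
    by (intro nn_integral_cmult[symmetric]) measurable
  also have "\<dots> \<le> (\<integral>\<^sup>+x. (\<integral>\<^sup>+z. ennreal ((norm (\<phi> (x + z) - \<phi> x))\<^sup>2) * indicator B z \<partial>lborel) \<partial>lborel)"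
    by (intro nn_integral_mono le)
  also have "\<dots> = (\<integral>\<^sup>+z. (\<integral>\<^sup>+x. ennreal ((norm (\<phi> (x + z) - \<phi> x))\<^sup>2) * indicator B z \<partial>lborel) \<partial>lborel)"
    by (intro lborel_pair.Fubini'[symmetric]) measurable
  also have "\<dots> = (\<integral>\<^sup>+z. (\<integral>\<^sup>+x. ennreal ((norm (\<phi> (x + z) - \<phi> x))\<^sup>2) \<partial>lborel) * indicator B z \<partial>lborel)"
    by (simp add: nn_integral_multc)
  also have "\<dots> \<le> (\<integral>\<^sup>+z. ennreal (h\<^sup>2) * ?I * indicator B z \<partial>lborel)"
  proof (rule nn_integral_mono)
    fix z :: "real ^ 'n"
    show "(\<integral>\<^sup>+x. ennreal ((norm (\<phi> (x + z) - \<phi> x))\<^sup>2) \<partial>lborel) * indicator B z \<le> ennreal (h\<^sup>2) * ?I * indicator B z"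
    proof (cases "z \<in> B")
      case True
      then have "(norm z)\<^sup>2 \<le> h\<^sup>2"
        by (intro power_mono) (auto simp: B_def)
      then have "ennreal ((norm z)\<^sup>2) * ?I \<le> ennreal (h\<^sup>2) * ?I"
        by (intro mult_right_mono ennreal_leI) auto
      then show ?thesis
        using True nn_integral_difference_square_le[OF assms(2), of z] by (simp add: order_trans)
    qed simp
  qed
  also have "\<dots> = ennreal (h\<^sup>2) * ?I * ennreal c"
    by (subst nn_integral_cmult_indicator) (simp_all add: eB)
  \<comment> \<open>Both sides may be infinite, so the positive finite factor \<open>c\<close> is
    removed by multiplying with its inverse.\<close>
  finally have "ennreal (1 / c) * (ennreal c * ?L) \<le> ennreal (1 / c) * (ennreal (h\<^sup>2) * ?I * ennreal c)"
    by (rule mult_left_mono) simp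
  moreover have "ennreal (1 / c) * (ennreal c * y) = y" for y
    using c by (simp flip: mult.assoc ennreal_mult)
  ultimately show ?thesis
    by (simp add: mult.commute[of _ "ennreal c"])
qed

text \<open>The difference of two averages is one average of
  \<open>\<phi> (x + z) - \<phi> (y + z)\<close>. Enlarging the ball to the whole space leaves a
  translation by \<open>x - y\<close>. The constant deteriorates as \<open>h\<close> tends to 0,
  which is harmless because \<open>h\<close> is fixed before compactness is invoked.\<close>

lemma ball_average_lipschitz:
  fixes \<phi> :: "real ^ 'n \<Rightarrow> 'b::euclidean_space"
  assumes "0 < h" "C_k (Suc 0) \<phi>" "0 \<le> b"
    and "(\<integral>\<^sup>+x. ennreal ((norm (gradient \<phi> x))\<^sup>2) \<partial>lborel) \<le> ennreal (b\<^sup>2)"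
  shows "norm (ball_average h \<phi> x - ball_average h \<phi> y)
    \<le> b / sqrt (measure lborel (cball (0 :: real ^ 'n) h)) * norm (x - y)"
proof -
  define c where "c = measure lborel (cball (0 :: real ^ 'n) h)"
  have c: "0 < c"
    unfolding c_def using assms(1) by (rule content_cball_pos)
  have cont: "continuous_on UNIV \<phi>"
    by (rule C_k_1_continuous[OF assms(2)])
  then have [measurable]: "\<phi> \<in> borel_measurable borel"
    by (rule borel_measurable_continuous_onI)
  have "ball_average h \<phi> x - ball_average h \<phi> y
      = (1 / c) *\<^sub>R (LINT z:cball 0 h|lborel. \<phi> (x + z) - \<phi> (y + z))"
    by (simp add: set_integral_cball_diff continuous_on_translate cont ball_average_def scaleR_diff_right c_def)
  then have "ennreal c * ennreal ((norm (ball_average h \<phi> x - ball_average h \<phi> y))\<^sup>2)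
      \<le> (\<integral>\<^sup>+z\<in>cball 0 h. ennreal ((norm (\<phi> (x + z) - \<phi> (y + z)))\<^sup>2) \<partial>lborel)"
    using norm_ball_average_square_le[OF assms(1), of "\<lambda>z. \<phi> (x + z) - \<phi> (y + z)"]
      continuous_on_diff[OF continuous_on_translate[OF cont] continuous_on_translate[OF cont]]
    by (simp add: c_def)
  also have "\<dots> \<le> (\<integral>\<^sup>+z. ennreal ((norm (\<phi> (x + z) - \<phi> (y + z)))\<^sup>2) \<partial>lborel)"
    by (intro nn_integral_mono) (simp add: indicator_def)
  also have "\<dots> = (\<integral>\<^sup>+z. ennreal ((norm (\<phi> ((z + y) + (x - y)) - \<phi> (z + y)))\<^sup>2) \<partial>lborel)"
    by (simp add: add.commute)
  also have "\<dots> = (\<integral>\<^sup>+z. ennreal ((norm (\<phi> (z + (x - y)) - \<phi> z))\<^sup>2) \<partial>lborel)"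
    by (rule nn_integral_lborel_translation[where g = "\<lambda>z. ennreal ((norm (\<phi> (z + (x - y)) - \<phi> z))\<^sup>2)"]) measurable
  also have "\<dots> \<le> ennreal ((norm (x - y))\<^sup>2) * ennreal (b\<^sup>2)"
    by (rule order_trans[OF nn_integral_difference_square_le[OF assms(2)]]) (intro mult_left_mono assms, simp)
  finally have "c * (norm (ball_average h \<phi> x - ball_average h \<phi> y))\<^sup>2 \<le> (norm (x - y))\<^sup>2 * b\<^sup>2"
    using c by (simp flip: ennreal_mult)
  then have "(norm (ball_average h \<phi> x - ball_average h \<phi> y))\<^sup>2 \<le> (b / sqrt c * norm (x - y))\<^sup>2"
    using c by (simp add: power_mult_distrib power_divide field_simps)
  then show ?thesis
    unfolding c_def by (rule power2_le_imp_le) (use assms(3) in simp)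
qed

lemma ball_average_bounded:
  fixes \<phi> :: "real ^ 'n \<Rightarrow> 'b::euclidean_space"
  assumes "0 < h" "continuous_on UNIV \<phi>" "0 \<le> b"
    and "(\<integral>\<^sup>+x. ennreal ((norm (\<phi> x))\<^sup>2) \<partial>lborel) \<le> ennreal (b\<^sup>2)"
  shows "norm (ball_average h \<phi> x) \<le> b / sqrt (measure lborel (cball (0 :: real ^ 'n) h))"
proof -
  define c where "c = measure lborel (cball (0 :: real ^ 'n) h)"
  have c: "0 < c"
    unfolding c_def using assms(1) by (rule content_cball_pos)
  have [measurable]: "\<phi> \<in> borel_measurable borel"
    using assms(2) by (rule borel_measurable_continuous_onI)
  have "ennreal c * ennreal ((norm (ball_average h \<phi> x))\<^sup>2)
      \<le> (\<integral>\<^sup>+z\<in>cball 0 h. ennreal ((norm (\<phi> (x + z)))\<^sup>2) \<partial>lborel)"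
    using norm_ball_average_square_le[OF assms(1) continuous_on_translate[OF assms(2)]]
    by (simp add: c_def ball_average_def)
  also have "\<dots> \<le> (\<integral>\<^sup>+z. ennreal ((norm (\<phi> (z + x)))\<^sup>2) \<partial>lborel)"
    by (intro nn_integral_mono) (simp add: indicator_def add.commute)
  also have "\<dots> = (\<integral>\<^sup>+z. ennreal ((norm (\<phi> z))\<^sup>2) \<partial>lborel)"
    by (rule nn_integral_lborel_translation[where g = "\<lambda>z. ennreal ((norm (\<phi> z))\<^sup>2)"]) measurable
  also have "\<dots> \<le> ennreal (b\<^sup>2)"
    by (rule assms)
  finally have "c * (norm (ball_average h \<phi> x))\<^sup>2 \<le> b\<^sup>2"
    using c by (simp flip: ennreal_mult)
  then have "(norm (ball_average h \<phi> x))\<^sup>2 \<le> (b / sqrt c)\<^sup>2"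
    using c by (simp add: power_divide field_simps)
  then show ?thesis
    unfolding c_def by (rule power2_le_imp_le) (use assms(3) in simp)
qed

section \<open>Rellich compactness\<close>

lemma test_fun_C1: "test_fun \<Omega> \<phi> \<Longrightarrow> C_k (Suc 0) \<phi>"
  unfolding test_fun_def by blast

lemma test_fun_support:
  assumes "test_fun \<Omega> \<phi>"
  obtains K where "compact K" "K \<subseteq> \<Omega>" "\<And>x. x \<notin> K \<Longrightarrow> \<phi> x = 0" "\<And>x. x \<notin> K \<Longrightarrow> gradient \<phi> x = 0"
  using assms gradient_eq_0_outside[OF compact_imp_closed] unfolding test_fun_def by metis

lemma l2_lebesgue_on_compact_support:
  fixes u :: "'a::euclidean_space \<Rightarrow> 'b::euclidean_space"
  assumes "\<Omega> \<in> sets lebesgue" "continuous_on UNIV u" "compact K" "\<And>x. x \<notin> K \<Longrightarrow> u x = 0"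
  shows "u \<in> l2 (lebesgue_on \<Omega>)"
proof -
  have m: "u \<in> borel_measurable borel"
    by (rule borel_measurable_continuous_onI[OF assms(2)])
  then have "(\<lambda>x. (norm (u x))\<^sup>2) \<in> borel_measurable lborel"
    by measurable
  moreover have "continuous_on K (\<lambda>x. (norm (u x))\<^sup>2)"
    by (intro continuous_intros continuous_on_subset[OF assms(2)]) simp
  from borel_integrable_compact[OF assms(3) this]
  have "integrable lborel (\<lambda>x. (norm (u x))\<^sup>2)"
    by (rule Bochner_Integration.integrable_cong[THEN iffD1, rotated -1]) (auto simp: indicator_def assms(4))
  ultimately have "integrable lebesgue (\<lambda>x. (norm (u x))\<^sup>2)"
    by (simp add: integrable_completion)
  from integrable_mult_indicator[OF assms(1) this]
  have "integrable (lebesgue_on \<Omega>) (\<lambda>x. (norm (u x))\<^sup>2)"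
    using assms(1) by (subst integrable_restrict_space) auto
  moreover have "u \<in> borel_measurable (lebesgue_on \<Omega>)"
    using m by (intro measurable_restrict_space1 measurable_completion) simp
  ultimately show ?thesis
    by (simp add: l2_def)
qed

lemma nn_integral_lebesgue_on:
  "\<Omega> \<in> sets lebesgue \<Longrightarrow> (\<integral>\<^sup>+x. g x \<partial>lebesgue_on \<Omega>) = (\<integral>\<^sup>+x\<in>\<Omega>. g x \<partial>lborel)"
  by (simp add: nn_integral_restrict_space nn_integral_completion)

lemma nn_integral_lborel_eq_l2norm:
  fixes u :: "'a::euclidean_space \<Rightarrow> 'b::euclidean_space"
  assumes "\<Omega> \<in> sets lebesgue" "u \<in> l2 (lebesgue_on \<Omega>)" "\<And>x. x \<notin> \<Omega> \<Longrightarrow> u x = 0"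
  shows "(\<integral>\<^sup>+x. ennreal ((norm (u x))\<^sup>2) \<partial>lborel) = ennreal ((l2norm (lebesgue_on \<Omega>) u)\<^sup>2)"
  unfolding l2norm_square_nn_integral[OF assms(2)] nn_integral_lebesgue_on[OF assms(1)]
  by (intro nn_integral_cong) (auto simp: indicator_def assms(3))

lemma l2norm_lebesgue_on_le:
  fixes u :: "'a::euclidean_space \<Rightarrow> 'b::euclidean_space"
  assumes "\<Omega> \<in> sets lebesgue" "u \<in> borel_measurable borel" "0 \<le> b"
    and "(\<integral>\<^sup>+x. ennreal ((norm (u x))\<^sup>2) \<partial>lborel) \<le> ennreal (b\<^sup>2)"
  shows "u \<in> l2 (lebesgue_on \<Omega>)" "l2norm (lebesgue_on \<Omega>) u \<le> b"
proof -
  have le: "(\<integral>\<^sup>+x. ennreal ((norm (u x))\<^sup>2) \<partial>lebesgue_on \<Omega>) \<le> ennreal (b\<^sup>2)"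
    unfolding nn_integral_lebesgue_on[OF assms(1)]
    by (rule order_trans[OF nn_integral_mono assms(4)]) (simp add: indicator_def)
  have "u \<in> borel_measurable (lebesgue_on \<Omega>)"
    using assms(2) by (intro measurable_restrict_space1 measurable_completion) simp
  then show u: "u \<in> l2 (lebesgue_on \<Omega>)"
    using le by (auto simp: l2_def integrable_iff_bounded intro: le_less_trans)
  have "(l2norm (lebesgue_on \<Omega>) u)\<^sup>2 \<le> b\<^sup>2"
    using le l2norm_square_nn_integral[OF u] by (metis ennreal_le_iff zero_le_power2)
  then show "l2norm (lebesgue_on \<Omega>) u \<le> b"
    using assms(3) by (rule power2_le_imp_le)
qed

lemma l2norm_le_bound:
  assumes "finite_measure M" "u \<in> l2 M" "\<And>x. x \<in> space M \<Longrightarrow> norm (u x) \<le> B" "0 \<le> B"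
  shows "l2norm M u \<le> B * sqrt (measure M (space M))"
proof (rule power2_le_imp_le)
  have "(l2norm M u)\<^sup>2 \<le> (LINT x|M. B\<^sup>2)"
    unfolding l2norm_square
    by (intro integral_mono l2_integrable assms(2) finite_measure.integrable_const assms(1) power_mono assms(3))
      auto
  then show "(l2norm M u)\<^sup>2 \<le> (B * sqrt (measure M (space M)))\<^sup>2"
    by (simp add: power_mult_distrib mult.commute)
qed (use assms(4) in simp)

text \<open>For a given tolerance, averages at a suitable fixed radius converge uniformly along a
  subsequence, which makes the late terms of the functions themselves close up to that tolerance.
  The radius depends on the tolerance, so successive subsequences are extracted and a diagonal one
  is taken.\<close>

lemma rellich:
  fixes \<Omega> :: "(real ^ 'n) set" and \<phi> :: "nat \<Rightarrow> real ^ 'n \<Rightarrow> complex"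
  assumes "open \<Omega>" "bounded \<Omega>" and test: "\<And>k. test_fun \<Omega> (\<phi> k)"
    and bound: "\<And>k. l2norm (lebesgue_on \<Omega>) (\<phi> k) \<le> b"
      "\<And>k. l2norm (lebesgue_on \<Omega>) (gradient (\<phi> k)) \<le> b"
  obtains r :: "nat \<Rightarrow> nat" where "strict_mono r" "l2_Cauchy (lebesgue_on \<Omega>) (\<lambda>k. \<phi> (r k))"
proof -
  let ?M = "lebesgue_on \<Omega>"
  have \<Omega>: "\<Omega> \<in> sets lebesgue" "\<Omega> \<in> lmeasurable"
    using assms(1,2) by (auto intro: lmeasurable_open bounded_set_imp_lmeasurable)
  have fin: "finite_measure ?M"
    by (rule finite_measure_lebesgue_on[OF \<Omega>(2)])
  have "0 \<le> b"
    using bound(1)[of 0] l2norm_nonneg order_trans by blast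
  note C1 = test_fun_C1[OF test]
  note cont = C_k_1_continuous[OF C1] and cont' = C_k_1_continuous_gradient[OF C1]
  have l2\<phi>: "\<phi> k \<in> l2 ?M" and l2\<phi>': "gradient (\<phi> k) \<in> l2 ?M" for k
  proof -
    obtain K where K: "compact K" "\<And>x. x \<notin> K \<Longrightarrow> \<phi> k x = 0" "\<And>x. x \<notin> K \<Longrightarrow> gradient (\<phi> k) x = 0"
      using test_fun_support[OF test[of k]] by metis
    show "\<phi> k \<in> l2 ?M" "gradient (\<phi> k) \<in> l2 ?M"
      by (rule l2_lebesgue_on_compact_support[OF \<Omega>(1) _ K(1)]; use cont cont' K(2,3) in simp)+
  qed
  have nn: "(\<integral>\<^sup>+x. ennreal ((norm (\<phi> k x))\<^sup>2) \<partial>lborel) \<le> ennreal (b\<^sup>2)"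
      "(\<integral>\<^sup>+x. ennreal ((norm (gradient (\<phi> k) x))\<^sup>2) \<partial>lborel) \<le> ennreal (b\<^sup>2)" for k
  proof -
    have z: "\<phi> k x = 0" "gradient (\<phi> k) x = 0" if "x \<notin> \<Omega>" for x
      using test_fun_support[OF test[of k]] that by (metis subsetD)+
    show "(\<integral>\<^sup>+x. ennreal ((norm (\<phi> k x))\<^sup>2) \<partial>lborel) \<le> ennreal (b\<^sup>2)"
      using nn_integral_lborel_eq_l2norm[OF \<Omega>(1) l2\<phi> z(1)] power_mono[OF bound(1) l2norm_nonneg]
      by (simp add: ennreal_leI)
    show "(\<integral>\<^sup>+x. ennreal ((norm (gradient (\<phi> k) x))\<^sup>2) \<partial>lborel) \<le> ennreal (b\<^sup>2)"
      using nn_integral_lborel_eq_l2norm[OF \<Omega>(1) l2\<phi>' z(2)] power_mono[OF bound(2) l2norm_nonneg]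
      by (simp add: ennreal_leI)
  qed
  \<comment> \<open>The tolerance attached to \<open>n\<close> is \<open>1 / (n + 1)\<close>. Being
    a statement about late terms, \<open>P n\<close> passes to further subsequences, as diagonal
    extraction requires.\<close>
  define P where "P n s \<longleftrightarrow> (\<exists>N. \<forall>k\<ge>N. \<forall>l\<ge>N.
      l2norm ?M (\<lambda>x. \<phi> (s k) x - \<phi> (s l) x) < inverse (real (Suc n)))" for n and s :: "nat \<Rightarrow> nat"
  interpret subseqs P
  proof
    fix n and s :: "nat \<Rightarrow> nat"
    assume "strict_mono s"
    define \<epsilon> where "\<epsilon> = inverse (real (Suc n))"
    have "0 < \<epsilon>"
      by (simp add: \<epsilon>_def)
    \<comment> \<open>The tolerance is split into quarters: one for the averaging error at each of
      the two indices and one for the distance of the averages; the fourth keeps the inequality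
      strict. The \<open>+ 1\<close> covers \<open>b = 0\<close>.\<close>
    define h where "h = \<epsilon> / (4 * (b + 1))"
    have h: "0 < h" "h * b \<le> \<epsilon> / 4"
      using \<open>0 < \<epsilon>\<close> \<open>0 \<le> b\<close> by (auto simp: h_def field_simps)
    define A where "A k = ball_average h (\<phi> (s k))" for k
    define L where "L = b / sqrt (measure lborel (cball (0 :: real ^ 'n) h))"
    have "0 \<le> L"
      using \<open>0 \<le> b\<close> by (simp add: L_def)
    have A_bounded: "norm (A k x) \<le> L" for k x
      unfolding A_def L_def by (rule ball_average_bounded[OF h(1) cont \<open>0 \<le> b\<close> nn(1)])
    have A_lip: "norm (A k x - A k y) \<le> L * norm (x - y)" for k x y
      unfolding A_def L_def by (rule ball_average_lipschitz[OF h(1) C1 \<open>0 \<le> b\<close> nn(2)])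
    have A_borel: "A k \<in> borel_measurable borel" for k
    proof -
      have "L-lipschitz_on UNIV (A k)"
        using A_lip \<open>0 \<le> L\<close> by (intro lipschitz_onI) (simp_all add: dist_norm)
      then show ?thesis
        by (intro borel_measurable_continuous_onI lipschitz_on_continuous_on)
    qed
    have A_close: "(\<lambda>x. A k x - \<phi> (s k) x) \<in> l2 ?M" "l2norm ?M (\<lambda>x. A k x - \<phi> (s k) x) \<le> \<epsilon> / 4" for k
    proof -
      have "(\<integral>\<^sup>+x. ennreal ((norm (A k x - \<phi> (s k) x))\<^sup>2) \<partial>lborel) \<le> ennreal (h\<^sup>2) * ennreal (b\<^sup>2)"
        unfolding A_def
        by (rule order_trans[OF ball_average_close[OF h(1) C1] mult_left_mono[OF nn(2)]]) simp
      then have le: "(\<integral>\<^sup>+x. ennreal ((norm (A k x - \<phi> (s k) x))\<^sup>2) \<partial>lborel) \<le> ennreal ((h * b)\<^sup>2)"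
        by (simp add: power_mult_distrib ennreal_mult)
      have m: "(\<lambda>x. A k x - \<phi> (s k) x) \<in> borel_measurable borel"
        by (intro borel_measurable_diff A_borel borel_measurable_continuous_onI cont)
      have "0 \<le> h * b"
        using h(1) \<open>0 \<le> b\<close> by simp
      from l2norm_lebesgue_on_le[OF \<Omega>(1) m this le] h(2)
      show "(\<lambda>x. A k x - \<phi> (s k) x) \<in> l2 ?M" "l2norm ?M (\<lambda>x. A k x - \<phi> (s k) x) \<le> \<epsilon> / 4"
        by linarith+
    qed
    have A_l2: "A k \<in> l2 ?M" for k
      using l2_add[OF A_close(1)[of k] l2\<phi>[of "s k"]] by simp
    have equicont: "\<exists>d>0. \<forall>k y. y \<in> closure \<Omega> \<and> norm (x - y) < d \<longrightarrow> norm (A k x - A k y) < e" if "0 < e" for x e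
    proof (intro exI[of _ "e / (L + 1)"] conjI allI impI)
      show "0 < e / (L + 1)"
        using \<open>0 < e\<close> \<open>0 \<le> L\<close> by simp
      fix k y
      assume "y \<in> closure \<Omega> \<and> norm (x - y) < e / (L + 1)"
      then have "(L + 1) * norm (x - y) < e"
        using \<open>0 \<le> L\<close> by (simp add: field_simps)
      then show "norm (A k x - A k y) < e"
        using A_lip[of k x y] norm_ge_zero[of "x - y"] unfolding distrib_right by linarith
    qed
    obtain g and r :: "nat \<Rightarrow> nat" where r: "strict_mono r"
      and g: "\<And>e. 0 < e \<Longrightarrow> \<exists>N. \<forall>k x. k \<ge> N \<and> x \<in> closure \<Omega> \<longrightarrow> norm (A (r k) x - g x) < e"
    proof (rule Arzela_Ascoli[of "closure \<Omega>" A L])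
      show "compact (closure \<Omega>)"
        using assms(2) by (simp add: compact_closure)
      fix g and r :: "nat \<Rightarrow> nat"
      assume "strict_mono r"
        "\<And>e. 0 < e \<Longrightarrow> \<exists>N. \<forall>k x. k \<ge> N \<and> x \<in> closure \<Omega> \<longrightarrow> norm (A (r k) x - g x) < e"
      then show thesis
        by (rule that)
    qed (rule A_bounded, rule equicont)
    define m where "m = sqrt (measure ?M (space ?M))"
    have "0 \<le> m"
      by (simp add: m_def)
    \<comment> \<open>A uniform distance of \<open>2 * \<delta>\<close> on a set of measure
      \<open>m^2\<close> costs at most \<open>2 * \<delta> * m\<close> in the L2 norm.\<close>
    define \<delta> where "\<delta> = \<epsilon> / (8 * (m + 1))"
    have \<delta>: "0 < \<delta>" "2 * \<delta> * m \<le> \<epsilon> / 4"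
      using \<open>0 < \<epsilon>\<close> \<open>0 \<le> m\<close> by (auto simp: \<delta>_def field_simps)
    obtain N where N: "\<And>k x. k \<ge> N \<Longrightarrow> x \<in> closure \<Omega> \<Longrightarrow> norm (A (r k) x - g x) < \<delta>"
      using g[OF \<delta>(1)] by blast
    have "l2norm ?M (\<lambda>x. \<phi> (s (r k)) x - \<phi> (s (r l)) x) < \<epsilon>" if "k \<ge> N" "l \<ge> N" for k l
    proof -
      have "norm (A (r k) x - A (r l) x) \<le> 2 * \<delta>" if "x \<in> \<Omega>" for x
      proof -
        have "x \<in> closure \<Omega>"
          using that closure_subset by blast
        then show ?thesis
          using N[OF \<open>k \<ge> N\<close>, of x] N[OF \<open>l \<ge> N\<close>, of x]
            norm_triangle_ineq4[of "A (r k) x - g x" "A (r l) x - g x"] by simp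
      qed
      then have 1: "l2norm ?M (\<lambda>x. A (r k) x - A (r l) x) \<le> \<epsilon> / 4"
        using l2norm_le_bound[OF fin l2_diff[OF A_l2[of "r k"] A_l2[of "r l"]], of "2 * \<delta>"] \<delta>
        by (simp add: m_def)
      have 2: "l2norm ?M (\<lambda>x. \<phi> (s (r k)) x - A (r k) x) \<le> \<epsilon> / 4"
        using A_close(2)[of "r k"] by (simp add: l2norm_minus_commute[of ?M "A (r k)"])
      have "l2norm ?M (\<lambda>x. \<phi> (s (r k)) x - \<phi> (s (r l)) x)
          \<le> l2norm ?M (\<lambda>x. \<phi> (s (r k)) x - A (r k) x) + l2norm ?M (\<lambda>x. A (r k) x - \<phi> (s (r l)) x)"
        by (rule l2norm_triangle_diff[OF l2\<phi> A_l2 l2\<phi>])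
      also have "l2norm ?M (\<lambda>x. A (r k) x - \<phi> (s (r l)) x)
          \<le> l2norm ?M (\<lambda>x. A (r k) x - A (r l) x) + l2norm ?M (\<lambda>x. A (r l) x - \<phi> (s (r l)) x)"
        by (rule l2norm_triangle_diff[OF A_l2 A_l2 l2\<phi>])
      finally show ?thesis
        using 1 2 A_close(2)[of "r l"] \<open>0 < \<epsilon>\<close> by linarith
    qed
    then show "\<exists>r'. strict_mono r' \<and> P n (s \<circ> r')"
      using r unfolding P_def \<epsilon>_def o_def by blast
  qed
  \<comment> \<open>From index \<open>Suc n\<close> on, the diagonal sequence is a subsequence of
    the one extracted for \<open>P n\<close>; hence the shift here and in the index bounds
    below.\<close>
  have P_diag: "P n (diagseq \<circ> ((+) (Suc n)))" for n
  proof (rule diagseq_holds)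
    fix r s :: "nat \<Rightarrow> nat" and n
    assume "strict_mono r" "P n s"
    then show "P n (s \<circ> r)"
      unfolding P_def o_def by (meson order_trans seq_suble)
  qed
  have "l2_Cauchy ?M (\<lambda>k. \<phi> (diagseq k))"
    unfolding l2_Cauchy_def
  proof (intro allI impI)
    fix e :: real
    assume "0 < e"
    then obtain n where n: "inverse (real (Suc n)) < e"
      using reals_Archimedean by blast
    obtain N where N: "\<And>k l. k \<ge> N \<Longrightarrow> l \<ge> N \<Longrightarrow>
        l2norm ?M (\<lambda>x. \<phi> (diagseq (Suc n + k)) x - \<phi> (diagseq (Suc n + l)) x) < inverse (real (Suc n))"
      using P_diag[of n] unfolding P_def o_def by blast
    have "l2norm ?M (\<lambda>x. \<phi> (diagseq k) x - \<phi> (diagseq l) x) < e" if "k \<ge> N + Suc n" "l \<ge> N + Suc n" for k l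
    proof -
      have "k - Suc n \<ge> N" "l - Suc n \<ge> N" "Suc n + (k - Suc n) = k" "Suc n + (l - Suc n) = l"
        using that by auto
      then show ?thesis
        using N[of "k - Suc n" "l - Suc n"] n by simp
    qed
    then show "\<exists>N. \<forall>k\<ge>N. \<forall>l\<ge>N. l2norm ?M (\<lambda>x. \<phi> (diagseq k) x - \<phi> (diagseq l) x) < e"
      by blast
  qed
  with subseq_diagseq show ?thesis
    by (rule that)
qed

section \<open>The Sobolev space as a closure\<close>

lemma partial_deriv_add:
  assumes "\<phi> differentiable (at x)" "\<psi> differentiable (at x)"
  shows "partial_deriv i (\<lambda>x. \<phi> x + \<psi> x) x = partial_deriv i \<phi> x + partial_deriv i \<psi> x"
  unfolding partial_deriv_def
  using fun_cong[OF frechet_derivative_at[OF has_derivative_add[OF assms[unfolded frechet_derivative_works]]],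
      of "axis i 1"]
  by (simp only:)

lemma has_derivative_bounded_linear_compose:
  assumes "bounded_linear T" "\<phi> differentiable (at x)"
  shows "((\<lambda>x. T (\<phi> x)) has_derivative (\<lambda>h. T (frechet_derivative \<phi> (at x) h))) (at x)"
  using bounded_linear.has_derivative[OF assms(1) assms(2)[unfolded frechet_derivative_works]] .

lemma partial_deriv_bounded_linear:
  assumes "bounded_linear T" "\<phi> differentiable (at x)"
  shows "partial_deriv i (\<lambda>x. T (\<phi> x)) x = T (partial_deriv i \<phi> x)"
  unfolding partial_deriv_def
  using fun_cong[OF frechet_derivative_at[OF has_derivative_bounded_linear_compose[OF assms]], of "axis i 1"]
  by (simp only:)

lemma C_k_add: "C_k k \<phi> \<Longrightarrow> C_k k \<psi> \<Longrightarrow> C_k k (\<lambda>x. \<phi> x + \<psi> x)"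
proof (induction k arbitrary: \<phi> \<psi>)
  case (Suc k)
  then have "partial_deriv i (\<lambda>x. \<phi> x + \<psi> x) = (\<lambda>x. partial_deriv i \<phi> x + partial_deriv i \<psi> x)" for i
    by (auto simp: partial_deriv_add)
  with Suc show ?case
    by auto
qed (auto intro: continuous_on_add)

lemma C_k_bounded_linear:
  assumes "bounded_linear T"
  shows "C_k k \<phi> \<Longrightarrow> C_k k (\<lambda>x. T (\<phi> x))"
proof (induction k arbitrary: \<phi>)
  case 0
  then show ?case
    using linear_continuous_on[OF assms] by (auto intro: continuous_on_compose2)
next
  case (Suc k)
  then have "partial_deriv i (\<lambda>x. T (\<phi> x)) = (\<lambda>x. T (partial_deriv i \<phi> x))" for i
    by (auto simp: partial_deriv_bounded_linear[OF assms])
  moreover have "(\<lambda>x. T (\<phi> x)) differentiable (at x)" for x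
    by (rule differentiableI[OF has_derivative_bounded_linear_compose[OF assms]]) (use Suc.prems in simp)
  ultimately show ?case
    using Suc by simp
qed

lemma test_fun_add:
  assumes "test_fun \<Omega> \<phi>" "test_fun \<Omega> \<psi>"
  shows "test_fun \<Omega> (\<lambda>x. \<phi> x + \<psi> x)" "gradient (\<lambda>x. \<phi> x + \<psi> x) x = gradient \<phi> x + gradient \<psi> x"
proof -
  obtain K where K: "compact K" "K \<subseteq> \<Omega>" "\<And>x. x \<notin> K \<Longrightarrow> \<phi> x = 0"
    using test_fun_support[OF assms(1)] by metis
  obtain L where L: "compact L" "L \<subseteq> \<Omega>" "\<And>x. x \<notin> L \<Longrightarrow> \<psi> x = 0"
    using test_fun_support[OF assms(2)] by metis
  have "\<exists>K. compact K \<and> K \<subseteq> \<Omega> \<and> (\<forall>x. x \<notin> K \<longrightarrow> \<phi> x + \<psi> x = 0)"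
    using K L by (intro exI[of _ "K \<union> L"]) (auto intro: compact_Un)
  then show "test_fun \<Omega> (\<lambda>x. \<phi> x + \<psi> x)"
    using assms by (auto simp: test_fun_def intro: C_k_add)
  show "gradient (\<lambda>x. \<phi> x + \<psi> x) x = gradient \<phi> x + gradient \<psi> x"
    using test_fun_C1[OF assms(1)] test_fun_C1[OF assms(2)]
    by (simp add: gradient_def vec_eq_iff partial_deriv_add)
qed

lemma test_fun_bounded_linear:
  assumes "bounded_linear T" "test_fun \<Omega> \<phi>"
  shows "test_fun \<Omega> (\<lambda>x. T (\<phi> x))" "gradient (\<lambda>x. T (\<phi> x)) x = (\<chi> i. T (gradient \<phi> x $ i))"
proof -
  interpret bounded_linear T
    by (rule assms(1))
  obtain K where "compact K" "K \<subseteq> \<Omega>" "\<And>x. x \<notin> K \<Longrightarrow> \<phi> x = 0"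
    using test_fun_support[OF assms(2)] by metis
  then have "\<exists>K. compact K \<and> K \<subseteq> \<Omega> \<and> (\<forall>x. x \<notin> K \<longrightarrow> T (\<phi> x) = 0)"
    by (intro exI[of _ K]) (simp add: zero)
  then show "test_fun \<Omega> (\<lambda>x. T (\<phi> x))"
    using assms(2) C_k_bounded_linear[OF assms(1)] unfolding test_fun_def by blast
  show "gradient (\<lambda>x. T (\<phi> x)) x = (\<chi> i. T (gradient \<phi> x $ i))"
    using test_fun_C1[OF assms(2)]
    by (simp add: gradient_def vec_eq_iff partial_deriv_bounded_linear[OF assms(1)])
qed

section \<open>The graph of the gradient and its closure\<close>

definition test_pairs :: "(real ^ 'n) set \<Rightarrow> (real ^ 'n \<Rightarrow> complex \<times> (complex ^ 'n)) set" where
  "test_pairs \<Omega> = {\<lambda>x. (\<phi> x, gradient \<phi> x) |\<phi>. test_fun \<Omega> \<phi>}"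

lemma test_pairsI: "test_fun \<Omega> \<phi> \<Longrightarrow> (\<lambda>x. (\<phi> x, gradient \<phi> x)) \<in> test_pairs \<Omega>"
  unfolding test_pairs_def by blast

lemma test_pairsE:
  assumes "U \<in> test_pairs \<Omega>"
  obtains \<phi> where "test_fun \<Omega> \<phi>" "U = (\<lambda>x. (\<phi> x, gradient \<phi> x))"
  using assms unfolding test_pairs_def by blast

lemma l2_subspace_test_pairs:
  fixes \<Omega> :: "(real ^ 'n) set"
  assumes "open \<Omega>"
  shows "l2_subspace (lebesgue_on \<Omega>) (test_pairs \<Omega>)"
  unfolding l2_subspace_def
proof (intro conjI ballI allI)
  have \<Omega>: "\<Omega> \<in> sets lebesgue"
    using assms by simp
  show "test_pairs \<Omega> \<subseteq> l2 (lebesgue_on \<Omega>)"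
  proof
    fix U
    assume "U \<in> test_pairs \<Omega>"
    then obtain \<phi> where \<phi>: "test_fun \<Omega> \<phi>" "U = (\<lambda>x. (\<phi> x, gradient \<phi> x))"
      by (rule test_pairsE)
    obtain K where K: "compact K" "\<And>x. x \<notin> K \<Longrightarrow> \<phi> x = 0" "\<And>x. x \<notin> K \<Longrightarrow> gradient \<phi> x = 0"
      using test_fun_support[OF \<phi>(1)] by metis
    show "U \<in> l2 (lebesgue_on \<Omega>)"
      unfolding \<phi>(2)
      by (rule l2_Pair[OF
            l2_lebesgue_on_compact_support[OF \<Omega> C_k_1_continuous[OF test_fun_C1[OF \<phi>(1)]] K(1,2)]
            l2_lebesgue_on_compact_support[OF \<Omega> C_k_1_continuous_gradient[OF test_fun_C1[OF \<phi>(1)]] K(1,3)]])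
  qed
  have "partial_deriv i (\<lambda>_. 0) = (\<lambda>_. 0 :: complex)" for i :: 'n
    by (simp add: partial_deriv_def fun_eq_iff)
  then have "C_k k (\<lambda>_ :: real ^ 'n. 0 :: complex)" for k
    by (induction k) auto
  then have "test_fun \<Omega> (\<lambda>_. 0)"
    by (auto simp: test_fun_def intro!: exI[of _ "{}"])
  from test_pairsI[OF this] show "(\<lambda>x. 0) \<in> test_pairs \<Omega>"
    by (simp add: gradient_def partial_deriv_def zero_prod_def zero_vec_def)
next
  fix u v
  assume "u \<in> test_pairs \<Omega>" "v \<in> test_pairs \<Omega>"
  then obtain \<phi> \<psi> where *: "test_fun \<Omega> \<phi>" "u = (\<lambda>x. (\<phi> x, gradient \<phi> x))"
      "test_fun \<Omega> \<psi>" "v = (\<lambda>x. (\<psi> x, gradient \<psi> x))"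
    by (elim test_pairsE) metis
  have "(\<lambda>x. u x + v x) = (\<lambda>x. (\<phi> x + \<psi> x, gradient (\<lambda>x. \<phi> x + \<psi> x) x))"
    by (simp add: * test_fun_add(2)[OF *(1,3)])
  then show "(\<lambda>x. u x + v x) \<in> test_pairs \<Omega>"
    using test_pairsI[OF test_fun_add(1)[OF *(1,3)]] by (simp only:)
next
  fix c :: real and u
  assume "u \<in> test_pairs \<Omega>"
  then obtain \<phi> where *: "test_fun \<Omega> \<phi>" "u = (\<lambda>x. (\<phi> x, gradient \<phi> x))"
    by (rule test_pairsE)
  have "(\<lambda>x. c *\<^sub>R u x) = (\<lambda>x. (c *\<^sub>R \<phi> x, gradient (\<lambda>x. c *\<^sub>R \<phi> x) x))"
    by (simp add: *(2) test_fun_bounded_linear(2)[OF bounded_linear_scaleR_right *(1)] vec_eq_iff fun_eq_iff)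
  then show "(\<lambda>x. c *\<^sub>R u x) \<in> test_pairs \<Omega>"
    using test_pairsI[OF test_fun_bounded_linear(1)[OF bounded_linear_scaleR_right *(1), of c]] by (simp only:)
qed

text \<open>The sum of the two squared distances is the squared \<open>l2norm\<close> of a
  difference of pairs, and the squares tend to 0 exactly when the norms do.\<close>

lemma has_H01_gradient_iff:
  fixes \<Omega> :: "(real ^ 'n) set"
  assumes "open \<Omega>"
  shows "has_H01_gradient \<Omega> u G \<longleftrightarrow> (\<lambda>x. (u x, G x)) \<in> l2_closure (lebesgue_on \<Omega>) (test_pairs \<Omega>)"
proof -
  let ?M = "lebesgue_on \<Omega>"
  have L2: "L2 \<Omega> = l2 ?M"
    by (simp add: L2_def l2_def)
  have pair: "(\<lambda>x. (\<phi> x, gradient \<phi> x)) \<in> l2 ?M" if "test_fun \<Omega> \<phi>" for \<phi>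
    using that l2_subspace_l2[OF l2_subspace_test_pairs[OF assms]] by (auto simp: test_pairs_def)
  have eq: "(LINT x|?M. (norm (\<phi> x - u x))\<^sup>2) + (LINT x|?M. (norm (gradient \<phi> x - G x))\<^sup>2)
      = (l2norm ?M (\<lambda>x. (\<phi> x, gradient \<phi> x) - (u x, G x)))\<^sup>2"
    if "test_fun \<Omega> \<phi>" "(\<lambda>x. (u x, G x)) \<in> l2 ?M" for \<phi>
    using l2norm_square_Pair[OF l2_diff[OF pair[OF that(1)] that(2)]] by (simp add: l2norm_square)
  have lim: "(\<lambda>k. (l2norm ?M (V k))\<^sup>2) \<longlonglongrightarrow> 0 \<longleftrightarrow> (\<lambda>k. l2norm ?M (V k)) \<longlonglongrightarrow> 0"
    for V :: "nat \<Rightarrow> real ^ 'n \<Rightarrow> complex \<times> (complex ^ 'n)"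
    using tendsto_power[of "\<lambda>k. l2norm ?M (V k)" 0 sequentially 2]
      tendsto_real_sqrt[of "\<lambda>k. (l2norm ?M (V k))\<^sup>2" 0 sequentially]
    by (auto simp: l2norm_nonneg)
  show ?thesis
  proof
    assume "has_H01_gradient \<Omega> u G"
    then obtain \<phi> where *: "u \<in> l2 ?M" "G \<in> l2 ?M" "\<And>k. test_fun \<Omega> (\<phi> k)"
      "(\<lambda>k. (LINT x|?M. (norm (\<phi> k x - u x))\<^sup>2) + (LINT x|?M. (norm (gradient (\<phi> k) x - G x))\<^sup>2)) \<longlonglongrightarrow> 0"
      unfolding has_H01_gradient_def L2 by blast
    note uG = l2_Pair[OF *(1,2)]
    have "l2_lim ?M (\<lambda>k x. (\<phi> k x, gradient (\<phi> k) x)) (\<lambda>x. (u x, G x))"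
      using *(4) unfolding eq[OF *(3) uG] lim l2_lim_def .
    then show "(\<lambda>x. (u x, G x)) \<in> l2_closure ?M (test_pairs \<Omega>)"
      by (rule l2_closureI[OF uG, rotated]) (rule test_pairsI[OF *(3)])
  next
    assume "(\<lambda>x. (u x, G x)) \<in> l2_closure ?M (test_pairs \<Omega>)"
    then obtain \<Phi> where *: "\<And>k. \<Phi> k \<in> test_pairs \<Omega>" "l2_lim ?M \<Phi> (\<lambda>x. (u x, G x))" "(\<lambda>x. (u x, G x)) \<in> l2 ?M"
      by (rule l2_closureE) blast
    have "\<exists>\<phi>. test_fun \<Omega> \<phi> \<and> \<Phi> k = (\<lambda>x. (\<phi> x, gradient \<phi> x))" for k
      using test_pairsE[OF *(1)[of k]] by metis
    then obtain \<phi> where \<phi>: "\<And>k. test_fun \<Omega> (\<phi> k)" "\<And>k. \<Phi> k = (\<lambda>x. (\<phi> k x, gradient (\<phi> k) x))"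
      by metis
    have "(\<lambda>k. (LINT x|?M. (norm (\<phi> k x - u x))\<^sup>2) + (LINT x|?M. (norm (gradient (\<phi> k) x - G x))\<^sup>2)) \<longlonglongrightarrow> 0"
      using *(2) unfolding eq[OF \<phi>(1) *(3)] lim l2_lim_def \<phi>(2) .
    then show "has_H01_gradient \<Omega> u G"
      using l2_fst[OF *(3)] l2_snd[OF *(3)] \<phi>(1) unfolding has_H01_gradient_def L2 by auto
  qed
qed

lemma has_H01_gradient_l2:
  fixes \<Omega> :: "(real ^ 'n) set"
  assumes "has_H01_gradient \<Omega> u G"
  shows "u \<in> l2 (lebesgue_on \<Omega>)" "G \<in> l2 (lebesgue_on \<Omega>)"
  using assms by (simp_all add: has_H01_gradient_def L2_def l2_def)

text \<open>\<open>T\<close> is linear over the reals, which admits conjugation. It acts on pairs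
  through \<open>S\<close>, a bounded map that sends test pairs to test pairs, and so it preserves
  the closure.\<close>

lemma has_H01_gradient_linear:
  fixes \<Omega> :: "(real ^ 'n) set" and T :: "complex \<Rightarrow> complex"
  assumes "open \<Omega>" "linear T" "has_H01_gradient \<Omega> u G"
  shows "has_H01_gradient \<Omega> (\<lambda>x. T (u x)) (\<lambda>x. \<chi> i. T (G x $ i))"
proof -
  let ?M = "lebesgue_on \<Omega>"
  interpret T: linear T
    by (rule assms(2))
  have bT: "bounded_linear T"
    using assms(2) by (simp add: linear_conv_bounded_linear)
  define S where "S p = (T (fst p), \<chi> i. T (snd p $ i))" for p :: "complex \<times> (complex ^ 'n)"
  have "linear S"
    by (rule linearI) (simp_all add: S_def T.add T.scaleR vec_eq_iff)
  then have bS: "bounded_linear S"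
    by (simp add: linear_conv_bounded_linear)
  have sub: "l2_subspace ?M (test_pairs \<Omega>)"
    by (rule l2_subspace_test_pairs[OF assms(1)])
  let ?U = "\<lambda>x. (u x, G x)"
  obtain \<Phi> where \<Phi>: "\<And>k. \<Phi> k \<in> test_pairs \<Omega>" "l2_lim ?M \<Phi> ?U" "?U \<in> l2 ?M"
    by (rule l2_closureE[OF assms(3)[unfolded has_H01_gradient_iff[OF assms(1)]]]) (rule that)
  obtain K where K: "\<And>p. norm (S p) \<le> norm p * K" "0 < K"
    using bounded_linear.pos_bounded[OF bS] by blast
  have "l2norm ?M (\<lambda>x. S (V x)) \<le> K * l2norm ?M V" if "V \<in> l2 ?M" for V
  proof (rule power2_le_imp_le)
    have "(norm (S (V x)))\<^sup>2 \<le> K\<^sup>2 * (norm (V x))\<^sup>2" for x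
      using power_mono[OF K(1) norm_ge_zero, of "V x" 2] by (simp add: power_mult_distrib mult.commute)
    then have "(LINT x|?M. (norm (S (V x)))\<^sup>2) \<le> (LINT x|?M. K\<^sup>2 * (norm (V x))\<^sup>2)"
      using l2_integrable[OF l2_bounded_linear[OF bS that]] l2_integrable[OF that]
      by (intro integral_mono) auto
    then show "(l2norm ?M (\<lambda>x. S (V x)))\<^sup>2 \<le> (K * l2norm ?M V)\<^sup>2"
      by (simp add: l2norm_square power_mult_distrib)
  qed (use K(2) in \<open>simp add: l2norm_nonneg\<close>)
  from this[OF l2_diff[OF l2_subspace_l2[OF sub \<Phi>(1)] \<Phi>(3)]]
  have le: "l2norm ?M (\<lambda>x. S (\<Phi> k x) - S (?U x)) \<le> K * l2norm ?M (\<lambda>x. \<Phi> k x - ?U x)" for k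
    unfolding linear_diff[OF \<open>linear S\<close>] .
  have "l2_lim ?M (\<lambda>k x. S (\<Phi> k x)) (\<lambda>x. S (?U x))"
    by (rule l2_limI[OF le tendsto_mult_right_zero[OF \<Phi>(2)[unfolded l2_lim_def]]])
  moreover have "(\<lambda>x. S (\<Phi> k x)) \<in> test_pairs \<Omega>" for k
  proof -
    obtain \<phi> where \<phi>: "test_fun \<Omega> \<phi>" "\<Phi> k = (\<lambda>x. (\<phi> x, gradient \<phi> x))"
      by (rule test_pairsE[OF \<Phi>(1)])
    have "(\<lambda>x. S (\<Phi> k x)) = (\<lambda>x. (T (\<phi> x), gradient (\<lambda>x. T (\<phi> x)) x))"
      by (simp add: S_def \<phi>(2) test_fun_bounded_linear(2)[OF bT \<phi>(1)])
    then show ?thesis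
      using test_pairsI[OF test_fun_bounded_linear(1)[OF bT \<phi>(1)]] by (simp only:)
  qed
  ultimately have "(\<lambda>x. S (?U x)) \<in> l2_closure ?M (test_pairs \<Omega>)"
    by (intro l2_closureI[OF l2_bounded_linear[OF bS \<Phi>(3)]])
  then show ?thesis
    using has_H01_gradient_iff[OF assms(1)] by (simp add: S_def)
qed

section \<open>Complex and real weak forms\<close>

lemma Re_cdot: "Re (cdot a b) = a \<bullet> (\<chi> i. cnj (b $ i))"
  by (simp add: cdot_def inner_vec_def inner_complex_def)

text \<open>The real inner product is the real part of the Hermitian one, which conjugates its
  second argument. The vector with entries \<open>\<i> * cnj (b $ i)\<close> therefore contributes
  \<open>- \<i> * b $ i\<close>, and \<open>Im z\<close> is the real part of
  \<open>- \<i> * z\<close>.\<close>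

lemma Im_cdot: "Im (cdot a b) = a \<bullet> (\<chi> i. \<i> * cnj (b $ i))"
  by (simp add: cdot_def inner_vec_def inner_complex_def algebra_simps)

lemma l2_integrable_cdot:
  fixes u v :: "'a \<Rightarrow> complex ^ 'n"
  assumes "u \<in> l2 M" "v \<in> l2 M"
  shows "integrable M (\<lambda>x. cdot (u x) (v x))"
proof -
  have nth: "(\<lambda>x. w x $ i) \<in> l2 M" if "w \<in> l2 M" for w :: "'a \<Rightarrow> complex ^ 'n" and i
    by (rule l2_bounded_linear[OF bounded_linear_vec_nth that])
  have "integrable M (\<lambda>x. u x $ i * v x $ i)" for i
    using l2_measurable[OF nth[OF assms(1), of i]] l2_measurable[OF nth[OF assms(2), of i]]
    by (intro l2_integrable_bilinear[OF bounded_bilinear_mult nth[OF assms(1)] nth[OF assms(2)]]) measurable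
  then show ?thesis
    unfolding cdot_def by auto
qed

lemma l2_integrable_mult:
  fixes u v :: "'a \<Rightarrow> complex"
  assumes "u \<in> l2 M" "v \<in> l2 M"
  shows "integrable M (\<lambda>x. u x * v x)"
  using l2_measurable[OF assms(1)] l2_measurable[OF assms(2)]
  by (intro l2_integrable_bilinear[OF bounded_bilinear_mult assms]) measurable

text \<open>Testing against \<open>cnj v\<close> and \<open>\<i> * cnj v\<close> recovers the real and imaginary parts of the complex
  weak form from the real one.\<close>

lemma weak_form_iff:
  fixes \<Omega> :: "(real ^ 'n) set"
  assumes "open \<Omega>" "Du \<in> l2 (lebesgue_on \<Omega>)" "g \<in> l2 (lebesgue_on \<Omega>)"
  shows "(\<forall>v Dv. has_H01_gradient \<Omega> v Dv \<longrightarrow>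
      (LINT x|lebesgue_on \<Omega>. cdot (Du x) (Dv x)) = (LINT x|lebesgue_on \<Omega>. g x * v x)) \<longleftrightarrow>
    (\<forall>V \<in> l2_closure (lebesgue_on \<Omega>) (test_pairs \<Omega>).
      (LINT x|lebesgue_on \<Omega>. Du x \<bullet> snd (V x)) = (LINT x|lebesgue_on \<Omega>. g x \<bullet> fst (V x)))"
    (is "?C \<longleftrightarrow> ?R")
proof -
  let ?M = "lebesgue_on \<Omega>"
  have lin: "linear cnj" "linear (\<lambda>z. \<i> * cnj z)"
    by (auto intro!: linearI simp: algebra_simps)
  note conj = has_H01_gradient_linear[OF assms(1) lin(1)] and iconj = has_H01_gradient_linear[OF assms(1) lin(2)]
  have Re_int: "Re (LINT x|?M. cdot (Du x) (Dv x)) = (LINT x|?M. Du x \<bullet> (\<chi> i. cnj (Dv x $ i)))"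
      "Re (LINT x|?M. g x * v x) = (LINT x|?M. g x \<bullet> cnj (v x))"
      "Im (LINT x|?M. cdot (Du x) (Dv x)) = (LINT x|?M. Du x \<bullet> (\<chi> i. \<i> * cnj (Dv x $ i)))"
      "Im (LINT x|?M. g x * v x) = (LINT x|?M. g x \<bullet> (\<i> * cnj (v x)))"
    if "has_H01_gradient \<Omega> v Dv" for v Dv
  proof -
    note v = has_H01_gradient_l2[OF that]
    have [simp]: "integrable ?M (\<lambda>x. cdot (Du x) (Dv x))" "integrable ?M (\<lambda>x. g x * v x)"
      by (rule l2_integrable_cdot[OF assms(2) v(2)], rule l2_integrable_mult[OF assms(3) v(1)])
    show "Re (LINT x|?M. cdot (Du x) (Dv x)) = (LINT x|?M. Du x \<bullet> (\<chi> i. cnj (Dv x $ i)))"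
        "Im (LINT x|?M. cdot (Du x) (Dv x)) = (LINT x|?M. Du x \<bullet> (\<chi> i. \<i> * cnj (Dv x $ i)))"
      by (simp_all flip: integral_Re integral_Im add: Re_cdot Im_cdot)
    show "Re (LINT x|?M. g x * v x) = (LINT x|?M. g x \<bullet> cnj (v x))"
        "Im (LINT x|?M. g x * v x) = (LINT x|?M. g x \<bullet> (\<i> * cnj (v x)))"
      by (simp_all flip: integral_Re integral_Im add: inner_complex_def algebra_simps)
  qed
  show ?thesis
  proof
    assume C: ?C
    show ?R
    proof
      fix V
      assume "V \<in> l2_closure ?M (test_pairs \<Omega>)"
      then have "has_H01_gradient \<Omega> (\<lambda>x. fst (V x)) (\<lambda>x. snd (V x))"
        by (simp add: has_H01_gradient_iff[OF assms(1)])
      from conj[OF this] C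
      show "(LINT x|?M. Du x \<bullet> snd (V x)) = (LINT x|?M. g x \<bullet> fst (V x))"
        using Re_int(1,2)[OF conj[OF \<open>has_H01_gradient \<Omega> (\<lambda>x. fst (V x)) (\<lambda>x. snd (V x))\<close>]] by simp
    qed
  next
    assume R: ?R
    have R': "(LINT x|?M. Du x \<bullet> Dv x) = (LINT x|?M. g x \<bullet> v x)" if "has_H01_gradient \<Omega> v Dv" for v Dv
      using R that unfolding has_H01_gradient_iff[OF assms(1)] by fastforce
    show ?C
    proof (intro allI impI complex_eqI)
      fix v Dv
      assume v: "has_H01_gradient \<Omega> v Dv"
      show "Re (LINT x|?M. cdot (Du x) (Dv x)) = Re (LINT x|?M. g x * v x)"
        unfolding Re_int[OF v] by (rule R'[OF conj[OF v]])
      show "Im (LINT x|?M. cdot (Du x) (Dv x)) = Im (LINT x|?M. g x * v x)"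
        unfolding Re_int[OF v] by (rule R'[OF iconj[OF v]])
    qed
  qed
qed

section \<open>The nonlinear problem\<close>

lemma l2norm_lipschitz_le:
  fixes F :: "'b::euclidean_space \<Rightarrow> 'c::euclidean_space"
  assumes "L-lipschitz_on UNIV F" "finite_measure M" "u \<in> l2 M" "v \<in> l2 M"
  shows "l2norm M (\<lambda>x. F (u x) - F (v x)) \<le> L * l2norm M (\<lambda>x. u x - v x)"
proof (rule power2_le_imp_le)
  have "0 \<le> L"
    by (rule lipschitz_on_nonneg[OF assms(1)])
  then show "0 \<le> L * l2norm M (\<lambda>x. u x - v x)"
    by (simp add: l2norm_nonneg)
  have "(norm (F (u x) - F (v x)))\<^sup>2 \<le> L\<^sup>2 * (norm (u x - v x))\<^sup>2" for x
    using power_mono[OF lipschitz_onD[OF assms(1), of "u x" "v x"], of 2]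
    by (simp add: dist_norm power_mult_distrib)
  then have "(LINT x|M. (norm (F (u x) - F (v x)))\<^sup>2) \<le> (LINT x|M. L\<^sup>2 * (norm (u x - v x))\<^sup>2)"
    using l2_integrable[OF l2_diff[OF l2_lipschitz[OF assms(1-3)] l2_lipschitz[OF assms(1,2,4)]]]
      l2_integrable[OF l2_diff[OF assms(3,4)]]
    by (intro integral_mono) auto
  then show "(l2norm M (\<lambda>x. F (u x) - F (v x)))\<^sup>2 \<le> (L * l2norm M (\<lambda>x. u x - v x))\<^sup>2"
    by (simp add: l2norm_square power_mult_distrib)
qed

text \<open>The summation behind Banach's fixed point theorem, carried out for representatives,
  where \<open>l2norm\<close> is only a seminorm.\<close>

lemma l2_Cauchy_geometric:
  assumes U: "\<And>k. U k \<in> l2 M" and q: "0 \<le> q" "q < 1"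
    and step: "\<And>k. l2norm M (\<lambda>x. U (Suc k) x - U k x) \<le> K * q ^ k"
  shows "l2_Cauchy M U"
proof -
  have "0 \<le> K"
    using step[of 0] l2norm_nonneg[of M "\<lambda>x. U (Suc 0) x - U 0 x"] by simp
  \<comment> \<open>The right-hand side is the exact sum of \<open>K * q ^ j\<close> over the
    \<open>n\<close> exponents from \<open>k\<close> on. Dropping the subtracted power before the
    induction is complete would prevent it from closing.\<close>
  have tail: "l2norm M (\<lambda>x. U (k + n) x - U k x) \<le> K / (1 - q) * (q ^ k - q ^ (k + n))" for k n
  proof (induction n)
    case 0
    then show ?case
      by (simp add: l2norm_def)
  next
    case (Suc n)
    have "l2norm M (\<lambda>x. U (k + Suc n) x - U k x)
        \<le> l2norm M (\<lambda>x. U (k + Suc n) x - U (k + n) x) + l2norm M (\<lambda>x. U (k + n) x - U k x)"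
      by (rule l2norm_triangle_diff[OF U U U])
    also have "\<dots> \<le> K * q ^ (k + n) + K / (1 - q) * (q ^ k - q ^ (k + n))"
      using step[of "k + n"] Suc by simp
    also have "K * q ^ (k + n) = K / (1 - q) * (q ^ (k + n) - q ^ (k + Suc n))"
      using q(2) by (simp add: field_simps)
    finally show ?case
      by (simp add: algebra_simps)
  qed
  have tail': "l2norm M (\<lambda>x. U (k + n) x - U k x) \<le> K / (1 - q) * q ^ k" for k n
  proof -
    have "K / (1 - q) * (q ^ k - q ^ (k + n)) \<le> K / (1 - q) * q ^ k"
      using q \<open>0 \<le> K\<close> by (intro mult_left_mono) auto
    then show ?thesis
      using tail[of k n] by linarith
  qed
  have "(\<lambda>k. K / (1 - q) * q ^ k) \<longlonglongrightarrow> 0"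
    using q by (intro tendsto_mult_right_zero LIMSEQ_power_zero) auto
  show ?thesis
    unfolding l2_Cauchy_def
  proof (intro allI impI)
    fix e :: real
    assume "0 < e"
    then obtain N where N: "norm (K / (1 - q) * q ^ N - 0) < e / 2"
      using LIMSEQ_D[OF \<open>(\<lambda>k. K / (1 - q) * q ^ k) \<longlonglongrightarrow> 0\<close>, of "e / 2"] by force
    have near: "l2norm M (\<lambda>x. U k x - U N x) < e / 2" if "k \<ge> N" for k
    proof -
      have k: "N + (k - N) = k"
        using that by simp
      have "K / (1 - q) * q ^ N < e / 2"
        by (rule le_less_trans[OF abs_ge_self N[unfolded real_norm_def diff_0_right]])
      then show ?thesis
        using tail'[of N "k - N"] unfolding k by linarith
    qed
    have "l2norm M (\<lambda>x. U k x - U l x) < e" if "k \<ge> N" "l \<ge> N" for k l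
      using l2norm_triangle_diff[OF U U U, of k l N] near[OF that(1)] near[OF that(2)]
      by (simp add: l2norm_minus_commute[of M "U N" "U l"])
    then show "\<exists>N. \<forall>k\<ge>N. \<forall>l\<ge>N. l2norm M (\<lambda>x. U k x - U l x) < e"
      by blast
  qed
qed

text \<open>By Rellich compactness the infimum \<open>\<mu>\<close> of the Rayleigh quotient is
  attained, so it is an eigenvalue, and \<open>\<nu> \<le> \<mu>\<close> because
  \<open>\<nu>\<close> is the smallest one.\<close>

lemma dirichlet_poincare:
  fixes \<Omega> :: "(real ^ 'n) set"
  assumes "open \<Omega>" "bounded \<Omega>" "smallest_dirichlet_eigenvalue \<Omega> \<nu>"
    and V: "V \<in> l2_closure (lebesgue_on \<Omega>) (test_pairs \<Omega>)"
  shows "\<nu> * (l2norm (lebesgue_on \<Omega>) (\<lambda>x. fst (V x)))\<^sup>2 \<le> (l2norm (lebesgue_on \<Omega>) (\<lambda>x. snd (V x)))\<^sup>2"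
proof -
  let ?M = "lebesgue_on \<Omega>"
  let ?W = "l2_closure ?M (test_pairs \<Omega>)"
  have D: "l2_subspace ?M (test_pairs \<Omega>)"
    by (rule l2_subspace_test_pairs[OF assms(1)])
  note Wl2 = l2_subspace_l2[OF l2_subspace_closure[OF D]]
  show ?thesis
  proof (cases "\<exists>V0 \<in> test_pairs \<Omega>. l2norm ?M (\<lambda>x. fst (V0 x)) \<noteq> 0")
    case True
    then obtain V0 where V0: "V0 \<in> test_pairs \<Omega>" "l2norm ?M (\<lambda>x. fst (V0 x)) \<noteq> 0"
      by blast
    have compact: "\<exists>r :: nat \<Rightarrow> nat. strict_mono r \<and> l2_Cauchy ?M (\<lambda>k x. fst (\<Phi> (r k) x))"
      if \<Phi>: "\<And>k. \<Phi> k \<in> test_pairs \<Omega>" "\<And>k. l2norm ?M (\<Phi> k) \<le> B"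
      for \<Phi> :: "nat \<Rightarrow> real ^ 'n \<Rightarrow> complex \<times> (complex ^ 'n)" and B
    proof -
      have "\<exists>\<phi>. test_fun \<Omega> \<phi> \<and> \<Phi> k = (\<lambda>x. (\<phi> x, gradient \<phi> x))" for k
        using test_pairsE[OF \<Phi>(1)[of k]] by metis
      then obtain \<phi> where \<phi>: "\<And>k. test_fun \<Omega> (\<phi> k)" "\<And>k. \<Phi> k = (\<lambda>x. (\<phi> k x, gradient (\<phi> k) x))"
        by metis
      have "l2norm ?M (\<phi> k) \<le> B" "l2norm ?M (gradient (\<phi> k)) \<le> B" for k
        using l2norm_fst_le[OF l2_subspace_l2[OF D \<Phi>(1)[of k]]] l2norm_snd_le[OF l2_subspace_l2[OF D \<Phi>(1)[of k]]]
          \<Phi>(2)[of k] unfolding \<phi>(2) by simp_all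
      from rellich[OF assms(1,2) \<phi>(1) this]
      obtain r :: "nat \<Rightarrow> nat" where "strict_mono r" "l2_Cauchy ?M (\<lambda>k. \<phi> (r k))" .
      then show ?thesis
        unfolding \<phi>(2) fst_conv by (intro exI[of _ r] conjI)
    qed
    obtain \<mu> U where U: "U \<in> ?W" "l2norm ?M (\<lambda>x. fst (U x)) \<noteq> 0"
      and \<mu>: "\<And>V. V \<in> ?W \<Longrightarrow> \<mu> * (l2norm ?M (\<lambda>x. fst (V x)))\<^sup>2 \<le> (l2norm ?M (\<lambda>x. snd (V x)))\<^sup>2"
      and eq: "\<And>V. V \<in> ?W \<Longrightarrow>
        (LINT x|?M. snd (U x) \<bullet> snd (V x)) = \<mu> * (LINT x|?M. fst (U x) \<bullet> fst (V x))"
    proof (rule l2_rayleigh_minimizer[OF D _ V0])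
      fix \<Phi> :: "nat \<Rightarrow> real ^ 'n \<Rightarrow> complex \<times> (complex ^ 'n)" and B
      assume "\<And>k. \<Phi> k \<in> test_pairs \<Omega>" "\<And>k. l2norm ?M (\<Phi> k) \<le> B"
      then show "\<exists>r :: nat \<Rightarrow> nat. strict_mono r \<and> l2_Cauchy ?M (\<lambda>k x. fst (\<Phi> (r k) x))"
        by (rule compact)
    qed (rule that)
    have grad: "has_H01_gradient \<Omega> (\<lambda>x. fst (U x)) (\<lambda>x. snd (U x))"
      using U(1) by (simp add: has_H01_gradient_iff[OF assms(1)])
    note Ul2 = has_H01_gradient_l2[OF grad]
    \<comment> \<open>The eigenvalue equation is a weak form whose right-hand side is
      \<open>\<mu>\<close> times the minimiser, so \<open>weak_form_iff\<close> turns it into the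
      complex one.\<close>
    have "\<forall>V \<in> ?W. (LINT x|?M. snd (U x) \<bullet> snd (V x)) = (LINT x|?M. (\<mu> *\<^sub>R fst (U x)) \<bullet> fst (V x))"
      using eq by simp
    from weak_form_iff[OF assms(1) Ul2(2) l2_scaleR[OF Ul2(1)], THEN iffD2, OF this]
    have "dirichlet_eigenvalue \<Omega> \<mu>"
      unfolding dirichlet_eigenvalue_def
      using grad U(2) l2norm_eq_0_iff[OF Ul2(1)]
      by (intro exI[of _ "\<lambda>x. fst (U x)"] exI[of _ "\<lambda>x. snd (U x)"]) (simp add: scaleR_conv_of_real mult.assoc)
    then have "\<nu> \<le> \<mu>"
      using assms(3) unfolding smallest_dirichlet_eigenvalue_def by blast
    then show ?thesis
      using \<mu>[OF V] mult_right_mono[of \<nu> \<mu> "(l2norm ?M (\<lambda>x. fst (V x)))\<^sup>2"] by simp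
  next
    \<comment> \<open>Without a test function of positive norm there is nothing to normalise. First
      components in the closure then have norm 0, and the left-hand side vanishes.\<close>
    case False
    obtain \<Phi> where \<Phi>: "\<And>k. \<Phi> k \<in> test_pairs \<Omega>" "l2_lim ?M \<Phi> V"
      by (rule l2_closureE[OF V]) (rule that)
    have "(\<lambda>k. l2norm ?M (\<lambda>x. fst (\<Phi> k x))) \<longlonglongrightarrow> l2norm ?M (\<lambda>x. fst (V x))"
      by (rule l2norm_tendsto[OF l2_fst[OF l2_subspace_l2[OF D \<Phi>(1)]] l2_fst[OF Wl2[OF V]]
            l2_lim_fst[OF l2_subspace_l2[OF D \<Phi>(1)] Wl2[OF V] \<Phi>(2), unfolded l2_lim_def]])
    moreover have "l2norm ?M (\<lambda>x. fst (\<Phi> k x)) = 0" for k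
      using False \<Phi>(1) by blast
    ultimately have "l2norm ?M (\<lambda>x. fst (V x)) = 0"
      by (simp only: LIMSEQ_const_iff)
    then show ?thesis
      by simp
  qed
qed

text \<open>This puts the nonlinear problem into the form of
  \<open>l2_energy_representation\<close>, with right-hand side \<open>f - F(u)\<close>. The first
  component has to equal \<open>u\<close> at every point, because \<open>u\<close> itself is the
  representative that has the gradient.\<close>

lemma weak_solution_iff:
  fixes \<Omega> :: "(real ^ 'n) set"
  assumes "open \<Omega>" "bounded \<Omega>" "L-lipschitz_on UNIV F" "f \<in> l2 (lebesgue_on \<Omega>)"
  shows "weak_solution \<Omega> F f u \<longleftrightarrow> (\<exists>U \<in> l2_closure (lebesgue_on \<Omega>) (test_pairs \<Omega>).
    (\<forall>x. fst (U x) = u x) \<and> (\<forall>V \<in> l2_closure (lebesgue_on \<Omega>) (test_pairs \<Omega>).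
      (LINT x|lebesgue_on \<Omega>. snd (U x) \<bullet> snd (V x))
      = (LINT x|lebesgue_on \<Omega>. (f x - F (u x)) \<bullet> fst (V x))))"
proof -
  let ?M = "lebesgue_on \<Omega>"
  let ?W = "l2_closure ?M (test_pairs \<Omega>)"
  have fin: "finite_measure ?M"
    using assms(1,2) by (intro finite_measure_lebesgue_on bounded_set_imp_lmeasurable) auto
  have key: "(\<forall>v Dv. has_H01_gradient \<Omega> v Dv \<longrightarrow>
        (LINT x|?M. cdot (Du x) (Dv x)) + (LINT x|?M. F (u x) * v x) = (LINT x|?M. f x * v x)) \<longleftrightarrow>
      (\<forall>V \<in> ?W. (LINT x|?M. Du x \<bullet> snd (V x)) = (LINT x|?M. (f x - F (u x)) \<bullet> fst (V x)))"
    if grad: "has_H01_gradient \<Omega> u Du" for Du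
  proof -
    note u = has_H01_gradient_l2[OF grad]
    note Fu = l2_lipschitz[OF assms(3) fin u(1)]
    have split: "(LINT x|?M. (f x - F (u x)) * v x) = (LINT x|?M. f x * v x) - (LINT x|?M. F (u x) * v x)"
      if "has_H01_gradient \<Omega> v Dv" for v Dv
      using l2_integrable_mult[OF assms(4) has_H01_gradient_l2(1)[OF that]]
        l2_integrable_mult[OF Fu has_H01_gradient_l2(1)[OF that]]
      by (simp add: left_diff_distrib)
    show ?thesis
      unfolding weak_form_iff[OF assms(1) u(2) l2_diff[OF assms(4) Fu], symmetric]
      by (intro all_cong1 imp_cong refl) (simp add: split eq_diff_eq)
  qed
  show ?thesis
  proof
    assume "weak_solution \<Omega> F f u"
    then obtain Du where Du: "has_H01_gradient \<Omega> u Du"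
        "\<forall>V \<in> ?W. (LINT x|?M. Du x \<bullet> snd (V x)) = (LINT x|?M. (f x - F (u x)) \<bullet> fst (V x))"
      unfolding weak_solution_def using key by blast
    show "\<exists>U \<in> ?W. (\<forall>x. fst (U x) = u x) \<and> (\<forall>V \<in> ?W.
        (LINT x|?M. snd (U x) \<bullet> snd (V x)) = (LINT x|?M. (f x - F (u x)) \<bullet> fst (V x)))"
      by (rule bexI[OF _ Du(1)[unfolded has_H01_gradient_iff[OF assms(1)]]]) (use Du(2) in simp)
  next
    assume "\<exists>U \<in> ?W. (\<forall>x. fst (U x) = u x) \<and> (\<forall>V \<in> ?W.
        (LINT x|?M. snd (U x) \<bullet> snd (V x)) = (LINT x|?M. (f x - F (u x)) \<bullet> fst (V x)))"
    then obtain U where U: "U \<in> ?W" "\<And>x. fst (U x) = u x" "\<forall>V \<in> ?W.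
        (LINT x|?M. snd (U x) \<bullet> snd (V x)) = (LINT x|?M. (f x - F (u x)) \<bullet> fst (V x))"
      by blast
    have grad: "has_H01_gradient \<Omega> u (\<lambda>x. snd (U x))"
      using U(1) by (simp add: has_H01_gradient_iff[OF assms(1)] flip: U(2))
    show "weak_solution \<Omega> F f u"
      unfolding weak_solution_def using grad key[OF grad, THEN iffD2, OF U(3)] by blast
  qed
qed

theorem theorem2p1:
  fixes \<Omega> :: "(real ^ 'n) set"
    and F :: "complex \<Rightarrow> complex"
    and f :: "real ^ 'n \<Rightarrow> complex"
    and lambda1 C C1 :: real
  assumes "open \<Omega>" and "connected \<Omega>" and "bounded \<Omega>" and "C1_boundary \<Omega>"
    and "smallest_dirichlet_eigenvalue \<Omega> lambda1" and "lambda1 > 0"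
    and "C = lambda1 powr (- 1 / 2)"
    and "C1-lipschitz_on UNIV F"
    and "C1 * C\<^sup>2 < 1"
    and "f \<in> L2 \<Omega>"
  shows "\<exists>u \<in> H01 \<Omega>. weak_solution \<Omega> F f u \<and>
           (\<forall>w \<in> H01 \<Omega>. weak_solution \<Omega> F f w \<longrightarrow> (AE x in lebesgue_on \<Omega>. w x = u x))"
proof -
  let ?M = "lebesgue_on \<Omega>"
  define W where "W = l2_closure ?M (test_pairs \<Omega>)"
  have D: "l2_subspace ?M (test_pairs \<Omega>)"
    by (rule l2_subspace_test_pairs[OF assms(1)])
  have W: "l2_subspace ?M W"
    unfolding W_def by (rule l2_subspace_closure[OF D])
  note Wl2 = l2_subspace_l2[OF W]
  have fin: "finite_measure ?M"
    using assms(1,3) by (intro finite_measure_lebesgue_on bounded_set_imp_lmeasurable) auto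
  have f: "f \<in> l2 ?M"
    using assms(10) by (simp add: L2_def l2_def)
  have "0 \<le> C1"
    by (rule lipschitz_on_nonneg[OF assms(8)])
  have "0 < C"
    using assms(6,7) by simp
  have "C\<^sup>2 * lambda1 = 1"
    using assms(6) unfolding assms(7) power2_eq_square powr_add[symmetric] by (simp add: powr_minus)
  have poincare: "l2norm ?M (\<lambda>x. fst (V x)) \<le> C * l2norm ?M (\<lambda>x. snd (V x))" if "V \<in> W" for V
  proof (rule power2_le_imp_le)
    have "C\<^sup>2 * (lambda1 * (l2norm ?M (\<lambda>x. fst (V x)))\<^sup>2) \<le> C\<^sup>2 * (l2norm ?M (\<lambda>x. snd (V x)))\<^sup>2"
      using dirichlet_poincare[OF assms(1,3,5)] that unfolding W_def by (intro mult_left_mono) auto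
    then show "(l2norm ?M (\<lambda>x. fst (V x)))\<^sup>2 \<le> (C * l2norm ?M (\<lambda>x. snd (V x)))\<^sup>2"
      using \<open>C\<^sup>2 * lambda1 = 1\<close> by (simp add: power_mult_distrib flip: mult.assoc)
  qed (use \<open>0 < C\<close> in \<open>simp add: l2norm_nonneg\<close>)
  define q where "q = C1 * C\<^sup>2"
  have q: "0 \<le> q" "q < 1"
    using \<open>0 \<le> C1\<close> assms(9) by (simp_all add: q_def)
  \<comment> \<open>The nonlinearity is frozen at \<open>g\<close>. Weak solutions of the nonlinear
    problem are the functions \<open>g\<close> that are first components of some \<open>U\<close>
    with \<open>solves U g\<close>, so existence and uniqueness both become statements about this
    relation.\<close>
  define solves where "solves U g \<longleftrightarrow> U \<in> W \<and> (\<forall>V \<in> W.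
      (LINT x|?M. snd (U x) \<bullet> snd (V x)) = (LINT x|?M. (f x - F (g x)) \<bullet> fst (V x)))"
    for U :: "real ^ 'n \<Rightarrow> complex \<times> (complex ^ 'n)" and g
  have solvable: "\<exists>U. solves U g" if g: "g \<in> l2 ?M" for g
  proof (rule l2_energy_representation[OF D _ l2_diff[OF f l2_lipschitz[OF assms(8) fin g]]])
    show "l2norm ?M (\<lambda>x. fst (V x)) \<le> C * l2norm ?M (\<lambda>x. snd (V x))"
      if "V \<in> l2_closure ?M (test_pairs \<Omega>)" for V
      using poincare that unfolding W_def .
    fix U
    assume "U \<in> l2_closure ?M (test_pairs \<Omega>)"
      "\<And>V. V \<in> l2_closure ?M (test_pairs \<Omega>) \<Longrightarrow>
        (LINT x|?M. snd (U x) \<bullet> snd (V x)) = (LINT x|?M. (f x - F (g x)) \<bullet> fst (V x))"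
    then show ?thesis
      unfolding solves_def W_def by (intro exI[of _ U]) blast
  qed
  \<comment> \<open>Both equations are tested with \<open>V = U - U'\<close>. Cauchy-Schwarz, the
    Lipschitz bound and Poincare for \<open>V\<close> give \<open>a^2\<close> at most
    \<open>C1 * C * a\<close> times the distance of \<open>g\<close> and \<open>g'\<close>. One
    \<open>a\<close> cancels, and a second use of Poincare passes from the gradient \<open>a\<close>
    back to the values.\<close>
  have contraction: "l2norm ?M (\<lambda>x. fst (U x) - fst (U' x)) \<le> q * l2norm ?M (\<lambda>x. g x - g' x)"
    if "solves U g" "solves U' g'" "g \<in> l2 ?M" "g' \<in> l2 ?M" for U U' g g'
  proof -
    define V where "V x = U x - U' x" for x
    define a where "a = l2norm ?M (\<lambda>x. snd (V x))"
    have UW: "U \<in> W" "U' \<in> W" and V: "V \<in> W"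
      using that l2_subspace_diff[OF W] unfolding solves_def V_def by blast+
    note Fg = l2_lipschitz[OF assms(8) fin that(3)] and Fg' = l2_lipschitz[OF assms(8) fin that(4)]
    have "a\<^sup>2 = (LINT x|?M. snd (U x) \<bullet> snd (V x) - snd (U' x) \<bullet> snd (V x))"
      unfolding a_def l2norm_square_inner
      by (rule Bochner_Integration.integral_cong) (simp_all add: V_def inner_diff_left)
    also have "\<dots> = (LINT x|?M. snd (U x) \<bullet> snd (V x)) - (LINT x|?M. snd (U' x) \<bullet> snd (V x))"
      by (rule Bochner_Integration.integral_diff[OF
            l2_integrable_inner[OF l2_snd[OF Wl2[OF UW(1)]] l2_snd[OF Wl2[OF V]]]
            l2_integrable_inner[OF l2_snd[OF Wl2[OF UW(2)]] l2_snd[OF Wl2[OF V]]]])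
    also have "\<dots> = (LINT x|?M. (f x - F (g x)) \<bullet> fst (V x)) - (LINT x|?M. (f x - F (g' x)) \<bullet> fst (V x))"
      using that(1,2) V unfolding solves_def by simp
    also have "\<dots> = (LINT x|?M. (f x - F (g x)) \<bullet> fst (V x) - (f x - F (g' x)) \<bullet> fst (V x))"
      by (rule Bochner_Integration.integral_diff[symmetric, OF
            l2_integrable_inner[OF l2_diff[OF f Fg] l2_fst[OF Wl2[OF V]]]
            l2_integrable_inner[OF l2_diff[OF f Fg'] l2_fst[OF Wl2[OF V]]]])
    also have "\<dots> = (LINT x|?M. (F (g' x) - F (g x)) \<bullet> fst (V x))"
      by (rule Bochner_Integration.integral_cong) (simp_all add: inner_diff_left)
    also have "\<dots> \<le> l2norm ?M (\<lambda>x. F (g' x) - F (g x)) * l2norm ?M (\<lambda>x. fst (V x))"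
      using l2_Cauchy_Schwarz[OF l2_diff[OF Fg' Fg] l2_fst[OF Wl2[OF V]]] by linarith
    also have "\<dots> \<le> (C1 * l2norm ?M (\<lambda>x. g x - g' x)) * (C * a)"
      using l2norm_lipschitz_le[OF assms(8) fin that(4,3)] poincare[OF V] \<open>0 \<le> C1\<close>
      by (intro mult_mono) (simp_all add: l2norm_nonneg a_def l2norm_minus_commute[of ?M g'])
    finally have "a * a \<le> (C1 * C * l2norm ?M (\<lambda>x. g x - g' x)) * a"
      by (simp add: power2_eq_square algebra_simps)
    then have "a \<le> C1 * C * l2norm ?M (\<lambda>x. g x - g' x)"
      using \<open>0 \<le> C1\<close> \<open>0 < C\<close> by (cases "a = 0") (auto simp: a_def l2norm_nonneg less_le)
    then have "C * a \<le> C * (C1 * C * l2norm ?M (\<lambda>x. g x - g' x))"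
      using \<open>0 < C\<close> by simp
    then show ?thesis
      using poincare[OF V] by (simp add: V_def a_def q_def power2_eq_square algebra_simps)
  qed
  \<comment> \<open>Any choice will do: by \<open>contraction\<close>, two solutions for the same
    \<open>g\<close> have first components at distance 0.\<close>
  obtain T where T: "\<And>g. g \<in> l2 ?M \<Longrightarrow> solves (T g) g"
    using solvable by metis
  have Tl2: "(\<lambda>x. fst (T g x)) \<in> l2 ?M" if "g \<in> l2 ?M" for g
    using T[OF that] Wl2 l2_fst unfolding solves_def by blast
  define u where "u = rec_nat (\<lambda>x. 0) (\<lambda>_ g x. fst (T g x))"
  have u_Suc: "u (Suc k) = (\<lambda>x. fst (T (u k) x))" for k
    by (simp add: u_def)
  have ul2: "u k \<in> l2 ?M" for k
    by (induction k) (simp add: u_def l2_const[OF fin], simp add: u_Suc Tl2)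
  have "l2norm ?M (\<lambda>x. u (Suc k) x - u k x) \<le> l2norm ?M (\<lambda>x. u (Suc 0) x - u 0 x) * q ^ k" for k
  proof (induction k)
    case (Suc k)
    have "l2norm ?M (\<lambda>x. u (Suc (Suc k)) x - u (Suc k) x) \<le> q * l2norm ?M (\<lambda>x. u (Suc k) x - u k x)"
      unfolding u_Suc[of "Suc k"] using contraction[OF T[OF ul2] T[OF ul2] ul2 ul2, of "Suc k" k]
      by (simp add: u_Suc)
    also have "\<dots> \<le> q * (l2norm ?M (\<lambda>x. u (Suc 0) x - u 0 x) * q ^ k)"
      using q(1) Suc by (intro mult_left_mono)
    finally show ?case
      by (simp add: algebra_simps)
  qed simp
  then have "l2_Cauchy ?M u"
    by (rule l2_Cauchy_geometric[OF ul2 q])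
  with ul2 obtain v where v: "v \<in> l2 ?M" "(\<lambda>k. l2norm ?M (\<lambda>x. u k x - v x)) \<longlonglongrightarrow> 0"
    by (rule l2_complete)
  \<comment> \<open>\<open>v\<close> agrees with its image only almost everywhere, whereas
    \<open>w\<close> is exactly the first component of an element of \<open>W\<close>, as
    \<open>weak_iff\<close> demands.\<close>
  define w where "w x = fst (T v x)" for x
  have w: "w \<in> l2 ?M"
    unfolding w_def using Tl2[OF v(1)] .
  have "l2norm ?M (\<lambda>x. w x - v x) = 0"
  proof -
    have "l2norm ?M (\<lambda>x. w x - v x) \<le> q * l2norm ?M (\<lambda>x. u k x - v x) + l2norm ?M (\<lambda>x. u (Suc k) x - v x)" for k
      using l2norm_triangle_diff[OF w ul2 v(1), of "Suc k"] contraction[OF T[OF v(1)] T[OF ul2] v(1) ul2, of k]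
      by (simp add: w_def u_Suc l2norm_minus_commute[of ?M v])
    moreover have "(\<lambda>k. q * l2norm ?M (\<lambda>x. u k x - v x) + l2norm ?M (\<lambda>x. u (Suc k) x - v x)) \<longlonglongrightarrow> q * 0 + 0"
      by (intro tendsto_add tendsto_mult tendsto_const v(2) LIMSEQ_Suc[OF v(2)])
    ultimately have "l2norm ?M (\<lambda>x. w x - v x) \<le> q * 0 + 0"
      by (intro LIMSEQ_le_const[where X = "\<lambda>k. q * l2norm ?M (\<lambda>x. u k x - v x) + l2norm ?M (\<lambda>x. u (Suc k) x - v x)"]) auto
    then show ?thesis
      using l2norm_nonneg[of ?M "\<lambda>x. w x - v x"] by simp
  qed
  then have wv: "AE x in ?M. w x = v x"
    using l2norm_eq_0_iff[OF l2_diff[OF w v(1)]] by simp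
  \<comment> \<open>\<open>T v\<close> was obtained with the nonlinearity frozen at
    \<open>v\<close>. Passing from \<open>v\<close> to \<open>w\<close> changes the integrand on the
    right only on a null set.\<close>
  have "solves (T v) w"
    unfolding solves_def
  proof (intro conjI ballI)
    show "T v \<in> W"
      using T[OF v(1)] unfolding solves_def by blast
    fix V
    assume V: "V \<in> W"
    have "(LINT x|?M. (f x - F (v x)) \<bullet> fst (V x)) = (LINT x|?M. (f x - F (w x)) \<bullet> fst (V x))"
    proof (rule integral_cong_AE)
      show "AE x in ?M. (f x - F (v x)) \<bullet> fst (V x) = (f x - F (w x)) \<bullet> fst (V x)"
        using wv by eventually_elim simp
    qed (intro borel_measurable_integrable l2_integrable_inner l2_diff f l2_lipschitz[OF assms(8) fin] v(1) w
        l2_fst Wl2[OF V])+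
    then show "(LINT x|?M. snd (T v x) \<bullet> snd (V x)) = (LINT x|?M. (f x - F (w x)) \<bullet> fst (V x))"
      using T[OF v(1)] V unfolding solves_def by simp
  qed
  have weak_iff: "weak_solution \<Omega> F f z \<longleftrightarrow> (\<exists>U. solves U z \<and> (\<forall>x. fst (U x) = z x))" for z
    unfolding weak_solution_iff[OF assms(1,3,8) f] solves_def W_def by blast
  have sol: "weak_solution \<Omega> F f w"
    unfolding weak_iff using \<open>solves (T v) w\<close> w_def by metis
  have "AE x in ?M. z x = w x" if z: "weak_solution \<Omega> F f z" for z
  proof -
    obtain U where U: "solves U z" "\<And>x. fst (U x) = z x"
      using z unfolding weak_iff by blast
    have zl2: "z \<in> l2 ?M"
      using l2_fst[OF Wl2, of U] U unfolding solves_def by simp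
    \<comment> \<open>A solution is its own frozen argument, so \<open>contraction\<close> bounds
      the distance of \<open>z\<close> and \<open>w\<close> by \<open>q\<close> times
      itself.\<close>
    have "l2norm ?M (\<lambda>x. z x - w x) \<le> q * l2norm ?M (\<lambda>x. z x - w x)"
      using contraction[OF U(1) \<open>solves (T v) w\<close> zl2 w] by (simp add: U(2) flip: w_def)
    then have "(1 - q) * l2norm ?M (\<lambda>x. z x - w x) \<le> 0"
      by (simp add: algebra_simps)
    then have "l2norm ?M (\<lambda>x. z x - w x) = 0"
      using q(2) l2norm_nonneg[of ?M "\<lambda>x. z x - w x"] by (simp add: mult_le_0_iff)
    then show ?thesis
      using l2norm_eq_0_iff[OF l2_diff[OF zl2 w]] by simp
  qed
  moreover have "w \<in> H01 \<Omega>"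
    using sol unfolding weak_solution_def H01_def by blast
  ultimately show ?thesis
    using sol by blast
qed

end
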